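(* Let $\alpha\ge 2$ be an integer and let $\Gamma^+_{\alpha,\alpha}$ be the positive part of the Diestel–Leader graph $\Gamma_{\alpha,\alpha}$. Then percolation on $\Gamma^+_{\alpha,\alpha}$ with parameter $p=p_c(\Gamma^+_{\alpha,\alpha})$ almost surely has no infinite clusters.
   Context: Percolation. For a connected, locally finite infinite graph $G=(V,E)$ and $0\le p\le 1$, percolation on $G$ with parameter $p$ is the random subset of $E(G)$ (the open edges) in which each edge is open independently with probability $p$; its law is $\mathbb{P}_p$. The cluster of a vertex is the set of vertices joined to it by a path of open edges. $p_c(G)=\inf\{p: \mathbb{P}_p(\text{there is an infinite cluster})=1\}$. Diestel–Leader graph $\Gamma_{\alpha,\alpha}$. Let $T_1$ and $T_2$ be two $(\alpha+1)$-regular trees. Choose an end in each tree (an equivalence class of half-infinite simple paths, two being equivalent if they differ in finitely many edges) and orient all edges of each tree towards its chosen end. Let $\Gamma'_{\alpha,\alpha}$ be the graph with vertex set $V(T_1)\times V(T_2)$ in which $\{(u_1,u_2),(v_1,v_2)\}$ is an edge iff $\{u_1,v_1\}\in E(T_1)$ and $\{u_2,v_2\}\in E(T_2)$ are oriented in opposite directions (that is, either $u_1\to v_1$ and $v_2\to u_2$, or $v_1\to u_1$ and $u_2\to v_2$). All connected components of this graph are isomorphic; $\Gamma_{\alpha,\alpha}$ is one such component. Let $\pi_1:\Gamma_{\alpha,\alpha}\to T_1$ be the projection to the first coordinate. Positive part. In $T_1$, a vertex $v$ is a descendant of $u$ if there is a directed path (possibly of length $0$) from $v$ to $u$. Fix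 a vertex $o$ of $\Gamma_{\alpha,\alpha}$. $\Gamma^+_{\alpha,\alpha}$ is the subgraph of $\Gamma_{\alpha,\alpha}$ induced by the vertices $v$ such that $\pi_1(v)$ is a descendant of $\pi_1(o)$. *)

theory Defs
  imports "HOL-Probability.Probability"
begin

section \<open>Simple graphs\<close>

record 'a sgraph =
  verts :: "'a set"
  edges :: "'a set set"

definition simple_graph :: "'a sgraph \<Rightarrow> bool" where
  "simple_graph G \<longleftrightarrow> (\<forall>e\<in>edges G. e \<subseteq> verts G \<and> card e = 2)"

definition joined :: "'a set set \<Rightarrow> 'a \<Rightarrow> 'a \<Rightarrow> bool" where
  "joined F = (\<lambda>x y. {x, y} \<in> F)\<^sup>*\<^sup>*"

definition connected_graph :: "'a sgraph \<Rightarrow> bool" where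
  "connected_graph G \<longleftrightarrow> verts G \<noteq> {} \<and> (\<forall>u\<in>verts G. \<forall>v\<in>verts G. joined (edges G) u v)"

definition induced_subgraph :: "'a sgraph \<Rightarrow> 'a set \<Rightarrow> 'a sgraph" where
  "induced_subgraph G W = \<lparr>verts = verts G \<inter> W, edges = {e \<in> edges G. e \<subseteq> W}\<rparr>"

definition graph_components :: "'a sgraph \<Rightarrow> 'a sgraph set" where
  "graph_components G =
     induced_subgraph G ` (verts G // {(u, v). u \<in> verts G \<and> v \<in> verts G \<and> joined (edges G) u v})"

definition regular_graph :: "nat \<Rightarrow> 'a sgraph \<Rightarrow> bool" where
  "regular_graph d G \<longleftrightarrow> (\<forall>v\<in>verts G. finite {e \<in> edges G. v \<in> e} \<and> card {e \<in> edges G. v \<in> e} = d)"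

text \<open>A cycle is given by the list of its vertices, without repeating the first one at the end.\<close>

definition graph_cycle :: "'a sgraph \<Rightarrow> 'a list \<Rightarrow> bool" where
  "graph_cycle G xs \<longleftrightarrow> 3 \<le> length xs \<and> distinct xs \<and>
     (\<forall>i<length xs. {xs ! i, xs ! (Suc i mod length xs)} \<in> edges G)"

definition tree_graph :: "'a sgraph \<Rightarrow> bool" where
  "tree_graph G \<longleftrightarrow> simple_graph G \<and> connected_graph G \<and> (\<nexists>xs. graph_cycle G xs)"

section \<open>Ends of a tree and the orientation towards an end\<close>

definition ray :: "'a sgraph \<Rightarrow> (nat \<Rightarrow> 'a) \<Rightarrow> bool" where
  "ray G r \<longleftrightarrow> inj r \<and> (\<forall>i. {r i, r (Suc i)} \<in> edges G)"

definition ray_edges :: "(nat \<Rightarrow> 'a) \<Rightarrow> 'a set set" where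
  "ray_edges r = range (\<lambda>i. {r i, r (Suc i)})"

definition ray_equiv :: "'a sgraph \<Rightarrow> ((nat \<Rightarrow> 'a) \<times> (nat \<Rightarrow> 'a)) set" where
  "ray_equiv G = {(r, s). ray G r \<and> ray G s \<and>
     finite ((ray_edges r - ray_edges s) \<union> (ray_edges s - ray_edges r))}"

definition tree_ends :: "'a sgraph \<Rightarrow> (nat \<Rightarrow> 'a) set set" where
  "tree_ends T = {r. ray T r} // ray_equiv T"

text \<open>
  In a tree every vertex \<open>u\<close> is the starting point of exactly one ray in the end \<open>\<xi>\<close>; the edge
  from \<open>u\<close> to \<open>v\<close> is oriented from \<open>u\<close> to \<open>v\<close> iff it is the first edge of that ray.
\<close>

definition towards :: "(nat \<Rightarrow> 'a) set \<Rightarrow> 'a \<Rightarrow> 'a \<Rightarrow> bool" where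
  "towards \<xi> u v \<longleftrightarrow> (\<exists>r\<in>\<xi>. r 0 = u \<and> r 1 = v)"

definition descendant :: "(nat \<Rightarrow> 'a) set \<Rightarrow> 'a \<Rightarrow> 'a \<Rightarrow> bool" where
  "descendant \<xi> v u \<longleftrightarrow> (towards \<xi>)\<^sup>*\<^sup>* v u"

section \<open>Diestel--Leader graphs\<close>

definition horocyclic_product ::
  "'a sgraph \<Rightarrow> (nat \<Rightarrow> 'a) set \<Rightarrow> 'b sgraph \<Rightarrow> (nat \<Rightarrow> 'b) set \<Rightarrow> ('a \<times> 'b) sgraph" where
  "horocyclic_product T1 \<xi>1 T2 \<xi>2 =
     \<lparr>verts = verts T1 \<times> verts T2,
      edges = {{(u1, u2), (v1, v2)} | u1 u2 v1 v2.
        {u1, v1} \<in> edges T1 \<and> {u2, v2} \<in> edges T2 \<and>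
        (towards \<xi>1 u1 v1 \<and> towards \<xi>2 v2 u2 \<or> towards \<xi>1 v1 u1 \<and> towards \<xi>2 u2 v2)}\<rparr>"

text \<open>
  \<open>\<Gamma>\<close> is a Diestel--Leader graph \<open>\<Gamma>\<^sub>\<alpha>\<^sub>,\<^sub>\<alpha>\<close>, built from the trees \<open>T1\<close>, \<open>T2\<close> with
  chosen ends \<open>\<xi>1\<close>, \<open>\<xi>2\<close>.
\<close>

definition diestel_leader ::
  "nat \<Rightarrow> 'a sgraph \<Rightarrow> (nat \<Rightarrow> 'a) set \<Rightarrow> 'b sgraph \<Rightarrow> (nat \<Rightarrow> 'b) set \<Rightarrow> ('a \<times> 'b) sgraph \<Rightarrow> bool" where
  "diestel_leader \<alpha> T1 \<xi>1 T2 \<xi>2 \<Gamma> \<longleftrightarrow>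
     tree_graph T1 \<and> regular_graph (\<alpha> + 1) T1 \<and> \<xi>1 \<in> tree_ends T1 \<and>
     tree_graph T2 \<and> regular_graph (\<alpha> + 1) T2 \<and> \<xi>2 \<in> tree_ends T2 \<and>
     \<Gamma> \<in> graph_components (horocyclic_product T1 \<xi>1 T2 \<xi>2)"

definition positive_part ::
  "(nat \<Rightarrow> 'a) set \<Rightarrow> ('a \<times> 'b) sgraph \<Rightarrow> 'a \<times> 'b \<Rightarrow> ('a \<times> 'b) sgraph" where
  "positive_part \<xi>1 \<Gamma> x0 = induced_subgraph \<Gamma> {v \<in> verts \<Gamma>. descendant \<xi>1 (fst v) (fst x0)}"

section \<open>Bernoulli bond percolation\<close>

text \<open>A configuration \<open>\<omega>\<close> maps each edge to its state, \<open>True\<close> meaning open.\<close>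

definition percolation :: "'a sgraph \<Rightarrow> real \<Rightarrow> ('a set \<Rightarrow> bool) measure" where
  "percolation G p = (\<Pi>\<^sub>M e\<in>edges G. measure_pmf (bernoulli_pmf p))"

definition open_edges :: "'a sgraph \<Rightarrow> ('a set \<Rightarrow> bool) \<Rightarrow> 'a set set" where
  "open_edges G \<omega> = {e \<in> edges G. \<omega> e}"

definition cluster :: "'a sgraph \<Rightarrow> ('a set \<Rightarrow> bool) \<Rightarrow> 'a \<Rightarrow> 'a set" where
  "cluster G \<omega> v = {w \<in> verts G. joined (open_edges G \<omega>) v w}"

definition has_infinite_cluster :: "'a sgraph \<Rightarrow> ('a set \<Rightarrow> bool) \<Rightarrow> bool" where
  "has_infinite_cluster G \<omega> \<longleftrightarrow> (\<exists>v\<in>verts G. infinite (cluster G \<omega> v))"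

definition critical_prob :: "'a sgraph \<Rightarrow> real" where
  "critical_prob G = Inf {p. 0 \<le> p \<and> p \<le> 1 \<and>
     measure (percolation G p) {\<omega> \<in> space (percolation G p). has_infinite_cluster G \<omega>} = 1}"

end

theory Submission
  imports Defs "HOL-Number_Theory.Cong" "HOL-Combinatorics.Transposition"
begin

text \<open>
  The positive part has a concrete model, the lamp graph: its vertices are the pairs \<open>(k, f)\<close> of a
  level \<open>k\<close> and a finitely supported lamp configuration \<open>f\<close> with values below \<open>\<alpha>\<close>, and \<open>(k, f)\<close> is joined
  to \<open>(k + 1, f(k := a))\<close> for every \<open>a < \<alpha>\<close>. The lamps below \<open>k\<close> record the position in the first
  tree below the root, the lamps from \<open>k\<close> on record the position in the second tree
  (\<open>graph_iso_code\<close>).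

  Let \<open>S\<^sub>n\<close> be the set of vertices of level \<open>n\<close> that are joined to the origin by open edges
  within the levels \<open>0, \<dots>, n\<close>. This happens inside a finite box, as the lamps from \<open>n\<close> on are
  never switched. The crucial geometric fact is that two different vertices \<open>w\<close> of level \<open>n\<close> in the box
  differ in a lamp below \<open>n\<close>, so the copies of the whole graph that start at them and stay in the
  levels \<open>\<ge> n\<close> are disjoint. Hence the sets \<open>S\<^sub>n, S\<^sub>2\<^sub>n, \<dots>\<close> dominate a
  branching process with offspring mean \<open>E |S\<^sub>n|\<close>.

  If \<open>E |S\<^sub>n| > 1\<close> for some \<open>n > 0\<close>, this process survives with positive probability (\<open>survival\<close>),
  and then there is an infinite cluster almost surely, because the graph contains infinitely many
  disjoint copies of itself (\<open>infinite_cluster_almost_surely\<close>). As \<open>E |S\<^sub>n|\<close> is a polynomial in \<open>p\<close>,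
  the condition \<open>E |S\<^sub>n| > 1\<close> also holds for slightly smaller \<open>p\<close>. Hence it fails at the critical
  parameter, for every \<open>n > 0\<close>.

  If, conversely, \<open>E |S\<^sub>n| \<le> 1\<close> for all \<open>n > 0\<close> and \<open>p < 1\<close>, then \<open>S\<^sub>n\<close> is with high probability of
  bounded size, and from every level on it has a chance bounded below to die at once, all edges
  going up being closed. So \<open>P(S\<^sub>n \<noteq> {})\<close> tends to \<open>0\<close> (\<open>extinction\<close>) and the origin
  has a finite cluster almost surely. Opening the finitely many edges of a path from the origin to
  another vertex costs only a constant factor, so all clusters are finite almost surely
  (\<open>no_infinite_cluster_if_extinction\<close>).
\<close>

section \<open>Events of percolation\<close>

text \<open>
  The probability of an event, given as a predicate on configurations. Configurations in the
  underlying space are undefined off the edges of \<open>G\<close>; the events considered here do not look there.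
\<close>

definition prb :: "'a sgraph \<Rightarrow> real \<Rightarrow> (('a set \<Rightarrow> bool) \<Rightarrow> bool) \<Rightarrow> real" where
  "prb G p Q = measure (percolation G p) {\<omega> \<in> space (percolation G p). Q \<omega>}"

text \<open>
  The event \<open>Q\<close> is a function of the states of the edges in \<open>K\<close>. For finite \<open>K\<close> such an event is
  measurable, its probability is polynomial in \<open>p\<close>, and events with disjoint \<open>K\<close> are independent.
\<close>

definition depends_on :: "'e set \<Rightarrow> (('e \<Rightarrow> bool) \<Rightarrow> bool) \<Rightarrow> bool" where
  "depends_on K Q \<longleftrightarrow> (\<forall>\<omega> \<omega>'. (\<forall>e\<in>K. \<omega> e = \<omega>' e) \<longrightarrow> Q \<omega> = Q \<omega>')"

lemma prob_space_percolation: "prob_space (percolation G p)"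
  unfolding percolation_def by (intro prob_space_PiM measure_pmf.prob_space_axioms)

lemma space_percolation: "space (percolation G p) = (\<Pi>\<^sub>E e\<in>edges G. UNIV)"
  by (simp add: percolation_def space_PiM)

lemma depends_on_restrict: "depends_on K Q \<Longrightarrow> Q (restrict \<omega> K) = Q \<omega>"
  by (simp add: depends_on_def)

lemma sets_PiM_bernoulli:
  assumes "finite K" "A \<subseteq> (\<Pi>\<^sub>E e\<in>K. UNIV)"
  shows "A \<in> sets (\<Pi>\<^sub>M e\<in>K. measure_pmf (bernoulli_pmf p))"
proof -
  have "sets (\<Pi>\<^sub>M e\<in>K. measure_pmf (bernoulli_pmf p)) = sets (\<Pi>\<^sub>M e\<in>K. count_space (UNIV::bool set))"
    by (intro sets_PiM_cong) auto
  also have "\<dots> = sets (count_space (\<Pi>\<^sub>E e\<in>K. (UNIV::bool set)))"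
    using assms(1) by (subst count_space_PiM_finite) (auto simp: o_def)
  finally show ?thesis using assms(2) by auto
qed

lemma depends_on_vimage:
  assumes "depends_on K Q"
  shows "{\<omega> \<in> space M. Q \<omega>} = (\<lambda>\<omega>. restrict \<omega> K) -` {\<eta> \<in> (\<Pi>\<^sub>E e\<in>K. UNIV). Q \<eta>} \<inter> space M"
  using depends_on_restrict[OF assms] by auto

lemma measurable_percolation_restrict:
  assumes "K \<subseteq> edges G"
  shows "(\<lambda>\<omega>. restrict \<omega> K) \<in> percolation G p \<rightarrow>\<^sub>M (\<Pi>\<^sub>M e\<in>K. measure_pmf (bernoulli_pmf p))"
  unfolding percolation_def by (rule measurable_restrict_subset[OF assms])

lemma sets_depends_on:
  assumes "finite K" "K \<subseteq> edges G" "depends_on K Q"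
  shows "{\<omega> \<in> space (percolation G p). Q \<omega>} \<in> sets (percolation G p)"
  unfolding depends_on_vimage[OF assms(3)]
  by (rule measurable_sets[OF measurable_percolation_restrict[OF assms(2)]
        sets_PiM_bernoulli[OF assms(1)]]) auto

lemma prb_depends_on_eq:
  assumes "finite K" "K \<subseteq> edges G" "depends_on K Q"
  shows "prb G p Q = (\<Sum>\<eta> | \<eta> \<in> (\<Pi>\<^sub>E e\<in>K. UNIV) \<and> Q \<eta>. \<Prod>e\<in>K. pmf (bernoulli_pmf p) (\<eta> e))"
proof -
  let ?B = "\<lambda>_. measure_pmf (bernoulli_pmf p)"
  let ?A = "{\<eta> \<in> (\<Pi>\<^sub>E e\<in>K. UNIV). Q \<eta>}"
  interpret K: finite_product_prob_space ?B K
    by unfold_locales (rule assms(1))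
  interpret G: product_prob_space ?B "edges G"
    by unfold_locales
  have fin: "finite ?A" using finite_PiE[OF assms(1), of "\<lambda>_. UNIV :: bool set"] by auto
  have sets: "B \<in> sets (PiM K ?B)" if "B \<subseteq> ?A" for B
    using that by (intro sets_PiM_bernoulli[OF assms(1)]) auto
  have "prb G p Q = measure (distr (PiM (edges G) ?B) (PiM K ?B) (\<lambda>\<omega>. restrict \<omega> K)) ?A"
    unfolding prb_def depends_on_vimage[OF assms(3)]
    using measurable_percolation_restrict[OF assms(2), of p] sets[OF order_refl]
    unfolding percolation_def by (subst measure_distr) simp_all
  also have "distr (PiM (edges G) ?B) (PiM K ?B) (\<lambda>\<omega>. restrict \<omega> K) = PiM K ?B"
    using assms by (intro G.distr_PiM_restrict_finite) auto
  also have "measure (PiM K ?B) ?A = (\<Sum>\<eta>\<in>?A. measure (PiM K ?B) {\<eta>})"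
    using fin by (intro K.finite_measure_eq_sum_singleton) (auto intro: sets)
  also have "\<dots> = (\<Sum>\<eta>\<in>?A. \<Prod>e\<in>K. pmf (bernoulli_pmf p) (\<eta> e))"
  proof (rule sum.cong[OF refl])
    fix \<eta> assume "\<eta> \<in> ?A"
    then have "{\<eta>} = (\<Pi>\<^sub>E e\<in>K. {\<eta> e})" using PiE_singleton[of \<eta> K] by (simp add: PiE_def)
    then have "measure (PiM K ?B) {\<eta>} = measure (PiM K ?B) (\<Pi>\<^sub>E e\<in>K. {\<eta> e})" by simp
    also have "\<dots> = (\<Prod>e\<in>K. measure (?B e) {\<eta> e})"
      by (intro K.finite_measure_PiM_emb) auto
    finally show "measure (PiM K ?B) {\<eta>} = (\<Prod>e\<in>K. pmf (bernoulli_pmf p) (\<eta> e))"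
      by (simp add: measure_pmf_single)
  qed
  finally show ?thesis .
qed

lemma continuous_on_prb:
  assumes "finite K" "K \<subseteq> edges G" "depends_on K Q"
  shows "continuous_on {0..1} (\<lambda>p. prb G p Q)"
proof -
  have pm: "pmf (bernoulli_pmf p) b = (if b then p else 1 - p)" if "p \<in> {0..1}" for p b
    using that by (cases b) auto
  have c: "continuous_on {0..1} (\<lambda>p::real. if b then p else 1 - p)" for b
    by (cases b) (auto intro!: continuous_intros)
  have "continuous_on {0..1} (\<lambda>p. \<Sum>\<eta> | \<eta> \<in> (\<Pi>\<^sub>E e\<in>K. UNIV) \<and> Q \<eta>. \<Prod>e\<in>K. if \<eta> e then p else 1 - p :: real)"
    by (intro continuous_on_sum continuous_on_prod c)
  then show ?thesis
    by (rule continuous_on_eq) (simp only: prb_depends_on_eq[OF assms] pm)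
qed

lemma indep_coordinates:
  assumes "edges G \<noteq> {}"
  shows "prob_space.indep_vars (percolation G p) (\<lambda>_. measure_pmf (bernoulli_pmf p)) (\<lambda>e \<omega>. \<omega> e) (edges G)"
proof -
  let ?B = "\<lambda>_. measure_pmf (bernoulli_pmf p)"
  interpret prob_space "percolation G p" by (rule prob_space_percolation)
  show ?thesis
  proof (subst indep_vars_iff_distr_eq_PiM'[OF assms])
    show "random_variable (?B i) (\<lambda>\<omega>. \<omega> i)" if "i \<in> edges G" for i
      using that unfolding percolation_def by (rule measurable_component_singleton)
    have "distr (percolation G p) (PiM (edges G) ?B) (\<lambda>x. \<lambda>i\<in>edges G. x i) = percolation G p"
    proof -
      have "distr (percolation G p) (PiM (edges G) ?B) (\<lambda>x. \<lambda>i\<in>edges G. x i)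
          = distr (percolation G p) (percolation G p) (\<lambda>x. x)"
        by (rule distr_cong) (auto simp: percolation_def space_PiM PiE_restrict)
      then show ?thesis by simp
    qed
    also have "\<dots> = (\<Pi>\<^sub>M i\<in>edges G. distr (percolation G p) (?B i) (\<lambda>\<omega>. \<omega> i))"
      unfolding percolation_def
      by (intro PiM_cong refl, subst distr_PiM_component) (auto intro: measure_pmf.prob_space_axioms)
    finally show "distr (percolation G p) (PiM (edges G) ?B) (\<lambda>x. \<lambda>i\<in>edges G. x i)
      = (\<Pi>\<^sub>M i\<in>edges G. distr (percolation G p) (?B i) (\<lambda>\<omega>. \<omega> i))" .
  qed
qed

lemma prb_True: "prb G p (\<lambda>_. True) = 1"
  unfolding prb_def using prob_space.prob_space[OF prob_space_percolation, of G p] by simp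

lemma prb_independent:
  assumes "finite J" "\<And>j. j \<in> J \<Longrightarrow> finite (K j)" "\<And>j. j \<in> J \<Longrightarrow> K j \<subseteq> edges G"
    and "disjoint_family_on K J" "\<And>j. j \<in> J \<Longrightarrow> depends_on (K j) (Q j)"
  shows "prb G p (\<lambda>\<omega>. \<forall>j\<in>J. Q j \<omega>) = (\<Prod>j\<in>J. prb G p (Q j))"
proof (cases "J = {} \<or> edges G = {}")
  case True
  show ?thesis
  proof (cases "J = {}")
    case True then show ?thesis by (simp add: prb_True)
  next
    case False
    then have "edges G = {}" using True by simp
    then have sp: "space (percolation G p) = {\<lambda>_. undefined}" by (simp add: space_percolation)
    have c: "prb G p R = of_bool (R (\<lambda>_. undefined))" for R
    proof (cases "R (\<lambda>_. undefined)")
      case True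
      then have "prb G p R = prb G p (\<lambda>_. True)" unfolding prb_def sp by (intro arg_cong2[where f=measure]) auto
      with True show ?thesis by (simp add: prb_True)
    next
      case False
      then have "{\<omega> \<in> space (percolation G p). R \<omega>} = {}" unfolding sp by auto
      with False show ?thesis unfolding prb_def by (simp only: measure_empty of_bool_eq)
    qed
    show ?thesis unfolding c using assms(1) by (induction J rule: finite_induct) auto
  qed
next
  case False
  let ?B = "\<lambda>_. measure_pmf (bernoulli_pmf p)"
  interpret prob_space "percolation G p" by (rule prob_space_percolation)
  have ind: "indep_vars (\<lambda>j. PiM (K j) ?B) (\<lambda>j \<omega>. restrict (\<lambda>i. \<omega> i) (K j)) J"
    using indep_vars_restrict[OF indep_coordinates assms(3,4)] False by blast
  define A where "A j = {\<eta> \<in> (\<Pi>\<^sub>E e\<in>K j. UNIV). Q j \<eta>}" for j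
  have eq: "{\<omega> \<in> space (percolation G p). Q j \<omega>} = (\<lambda>\<omega>. restrict \<omega> (K j)) -` A j \<inter> space (percolation G p)"
    if "j \<in> J" for j unfolding A_def by (rule depends_on_vimage[OF assms(5)[OF that]])
  have "{\<omega> \<in> space (percolation G p). \<forall>j\<in>J. Q j \<omega>}
      = (\<Inter>j\<in>J. (\<lambda>\<omega>. restrict \<omega> (K j)) -` A j \<inter> space (percolation G p))"
  proof (rule set_eqI)
    fix \<omega>
    have "\<omega> \<in> (\<Inter>j\<in>J. (\<lambda>\<omega>. restrict \<omega> (K j)) -` A j \<inter> space (percolation G p))
        \<longleftrightarrow> (\<forall>j\<in>J. \<omega> \<in> {\<omega> \<in> space (percolation G p). Q j \<omega>})" using eq by blast
    then show "\<omega> \<in> {\<omega> \<in> space (percolation G p). \<forall>j\<in>J. Q j \<omega>}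
        \<longleftrightarrow> \<omega> \<in> (\<Inter>j\<in>J. (\<lambda>\<omega>. restrict \<omega> (K j)) -` A j \<inter> space (percolation G p))"
      using False by auto
  qed
  then have "prb G p (\<lambda>\<omega>. \<forall>j\<in>J. Q j \<omega>)
      = prob (\<Inter>j\<in>J. (\<lambda>\<omega>. restrict \<omega> (K j)) -` A j \<inter> space (percolation G p))" by (simp add: prb_def)
  also have "\<dots> = (\<Prod>j\<in>J. prob ((\<lambda>\<omega>. restrict \<omega> (K j)) -` A j \<inter> space (percolation G p)))"
    using False assms(1,2)
    by (intro indep_varsD[OF ind]) (auto simp: A_def intro: sets_PiM_bernoulli)
  also have "\<dots> = (\<Prod>j\<in>J. prb G p (Q j))"
    by (intro prod.cong refl) (simp add: prb_def eq)
  finally show ?thesis .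
qed

lemma prb_independent2:
  assumes "finite K" "K \<subseteq> edges G" "depends_on K Q" "finite L" "L \<subseteq> edges G" "depends_on L R" "K \<inter> L = {}"
  shows "prb G p (\<lambda>\<omega>. Q \<omega> \<and> R \<omega>) = prb G p Q * prb G p R"
proof -
  have "prb G p (\<lambda>\<omega>. \<forall>j\<in>{True, False}. (if j then Q else R) \<omega>)
      = (\<Prod>j\<in>{True, False}. prb G p (if j then Q else R))"
    using assms by (intro prb_independent[of _ "\<lambda>j. if j then K else L"])
      (auto simp: disjoint_family_on_def)
  moreover have "(\<forall>j\<in>{True, False}. (if j then Q else R) \<omega>) \<longleftrightarrow> Q \<omega> \<and> R \<omega>" for \<omega> by auto
  ultimately show ?thesis by simp
qed

text \<open>
  Transporting the states along an injection of edge sets turns percolation into percolation. This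
  serves both for graph isomorphisms and for copies of a graph inside itself.
\<close>

lemma prb_reindex:
  assumes "inj_on \<phi> (edges H)" "\<phi> ` edges H \<subseteq> edges G"
    and "{\<omega> \<in> space (percolation H p). Q \<omega>} \<in> sets (percolation H p)"
  shows "prb G p (\<lambda>\<omega>. Q (\<lambda>e\<in>edges H. \<omega> (\<phi> e))) = prb H p Q"
proof -
  let ?B = "\<lambda>_. measure_pmf (bernoulli_pmf p)"
  let ?T = "\<lambda>\<omega>. \<lambda>e\<in>edges H. \<omega> (\<phi> e)"
  have T: "?T \<in> percolation G p \<rightarrow>\<^sub>M percolation H p"
    unfolding percolation_def using assms(2)
    by (intro measurable_restrict measurable_component_singleton) auto
  have d: "distr (percolation G p) (percolation H p) ?T = percolation H p"
    unfolding percolation_def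
    by (rule distr_PiM_reindex) (use assms in \<open>auto intro: measure_pmf.prob_space_axioms\<close>)
  have "prb H p Q = measure (distr (percolation G p) (percolation H p) ?T) {\<omega> \<in> space (percolation H p). Q \<omega>}"
    unfolding d by (simp add: prb_def)
  also have "\<dots> = measure (percolation G p) (?T -` {\<omega> \<in> space (percolation H p). Q \<omega>} \<inter> space (percolation G p))"
    by (rule measure_distr[OF T assms(3)])
  also have "?T -` {\<omega> \<in> space (percolation H p). Q \<omega>} \<inter> space (percolation G p)
      = {\<omega> \<in> space (percolation G p). Q (?T \<omega>)}"
    using measurable_space[OF T] by auto
  finally show ?thesis by (simp add: prb_def)
qed

lemma prb_open:
  assumes "0 \<le> p" "p \<le> 1" "finite F" "F \<subseteq> edges G"
  shows "prb G p (\<lambda>\<omega>. \<forall>e\<in>F. \<omega> e) = p ^ card F"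
    and "prb G p (\<lambda>\<omega>. \<forall>e\<in>F. \<not> \<omega> e) = (1 - p) ^ card F"
proof -
  have 1: "prb G p (\<lambda>\<omega>. \<omega> e = b) = (if b then p else 1 - p)" if "e \<in> F" for e b
  proof -
    have dep: "depends_on {e} (\<lambda>\<omega>. \<omega> e = b)" by (auto simp: depends_on_def)
    have "{\<eta>. \<eta> \<in> (\<Pi>\<^sub>E e\<in>{e}. UNIV) \<and> \<eta> e = b} = {\<lambda>x\<in>{e}. b}"
    proof (intro set_eqI iffI)
      fix \<eta> assume "\<eta> \<in> {\<eta>. \<eta> \<in> (\<Pi>\<^sub>E e\<in>{e}. UNIV) \<and> \<eta> e = b}"
      then have "\<eta> = (\<lambda>x\<in>{e}. b)" by (intro extensionalityI[of _ "{e}"]) (auto simp: PiE_def)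
      then show "\<eta> \<in> {\<lambda>x\<in>{e}. b}" by (rule ssubst) (rule singletonI)
    next
      fix \<eta> assume "\<eta> \<in> {\<lambda>x\<in>{e}. b}"
      then have "\<eta> = (\<lambda>x\<in>{e}. b)" by (rule singletonD)
      then show "\<eta> \<in> {\<eta>. \<eta> \<in> (\<Pi>\<^sub>E e\<in>{e}. UNIV) \<and> \<eta> e = b}" by (rule ssubst) (simp add: PiE_def extensional_def)
    qed
    moreover have "prb G p (\<lambda>\<omega>. \<omega> e = b)
        = (\<Sum>\<eta> | \<eta> \<in> (\<Pi>\<^sub>E e\<in>{e}. UNIV) \<and> \<eta> e = b. \<Prod>e\<in>{e}. pmf (bernoulli_pmf p) (\<eta> e))"
      using that assms by (intro prb_depends_on_eq dep) auto
    ultimately show ?thesis using assms by (cases b) auto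
  qed
  have 2: "prb G p (\<lambda>\<omega>. \<forall>e\<in>F. \<omega> e = b) = (\<Prod>e\<in>F. prb G p (\<lambda>\<omega>. \<omega> e = b))" for b
    using assms by (intro prb_independent[where K="\<lambda>e. {e}"]) (auto simp: disjoint_family_on_def depends_on_def)
  show "prb G p (\<lambda>\<omega>. \<forall>e\<in>F. \<omega> e) = p ^ card F"
    using 2[of True] 1[of _ True] by simp
  show "prb G p (\<lambda>\<omega>. \<forall>e\<in>F. \<not> \<omega> e) = (1 - p) ^ card F"
    using 2[of False] 1[of _ False] by simp
qed

lemma prb_nonneg [simp]: "0 \<le> prb G p Q"
  by (simp add: prb_def)

lemma prb_mono:
  assumes "\<And>\<omega>. Q \<omega> \<Longrightarrow> R \<omega>" "{\<omega> \<in> space (percolation G p). R \<omega>} \<in> sets (percolation G p)"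
  shows "prb G p Q \<le> prb G p R"
proof -
  interpret prob_space "percolation G p" by (rule prob_space_percolation)
  show ?thesis unfolding prb_def by (rule finite_measure_mono) (use assms in auto)
qed

lemma prb_le_1 [simp]: "prb G p Q \<le> 1"
  unfolding prb_def using prob_space.prob_le_1[OF prob_space_percolation] by blast

lemma prb_not:
  assumes "{\<omega> \<in> space (percolation G p). Q \<omega>} \<in> sets (percolation G p)"
  shows "prb G p (\<lambda>\<omega>. \<not> Q \<omega>) = 1 - prb G p Q"
  unfolding prb_def by (rule prob_space.prob_neg[OF prob_space_percolation assms])

lemma prb_total:
  assumes "finite I" "\<And>\<omega>. X \<omega> \<in> I"
    and "\<And>i. i \<in> I \<Longrightarrow> {\<omega> \<in> space (percolation G p). X \<omega> = i \<and> Q \<omega>} \<in> sets (percolation G p)"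
  shows "prb G p Q = (\<Sum>i\<in>I. prb G p (\<lambda>\<omega>. X \<omega> = i \<and> Q \<omega>))"
proof -
  interpret prob_space "percolation G p" by (rule prob_space_percolation)
  let ?A = "\<lambda>i. {\<omega> \<in> space (percolation G p). X \<omega> = i \<and> Q \<omega>}"
  have "{\<omega> \<in> space (percolation G p). Q \<omega>} = (\<Union>i\<in>I. ?A i)" using assms(2) by auto
  also have "prob \<dots> = (\<Sum>i\<in>I. prob (?A i))"
    using assms by (intro finite_measure_finite_Union) (auto simp: disjoint_family_on_def)
  finally show ?thesis by (simp add: prb_def)
qed

lemma depends_on_conj: "depends_on K Q \<Longrightarrow> depends_on L R \<Longrightarrow> depends_on (K \<union> L) (\<lambda>\<omega>. Q \<omega> \<and> R \<omega>)"
  unfolding depends_on_def by blast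

lemma depends_on_Ball:
  "(\<And>j. j \<in> J \<Longrightarrow> depends_on (K j) (Q j)) \<Longrightarrow> depends_on (\<Union>j\<in>J. K j) (\<lambda>\<omega>. \<forall>j\<in>J. Q j \<omega>)"
  unfolding depends_on_def by (intro allI impI ball_cong refl) blast

text \<open>
  An upper bound of Bonferroni type, obtained from Bernoulli's inequality for \<open>(1 + x)\<^sup>n\<close>.
\<close>

lemma power_one_minus_le:
  fixes x :: real
  assumes "0 \<le> x" "x \<le> 1"
  shows "(1 - x) ^ n \<le> 1 - x * n + (x * n)\<^sup>2"
proof -
  let ?y = "x * n"
  have y: "0 \<le> ?y" using assms by simp
  have "(1 - x) ^ n * (1 + ?y) \<le> (1 - x) ^ n * (1 + x) ^ n"
    using assms Bernoulli_inequality[of x n] by (intro mult_left_mono) (auto simp: mult.commute)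
  also have "\<dots> = (1 - x\<^sup>2) ^ n"
    by (simp add: power_mult_distrib[symmetric] power2_eq_square algebra_simps)
  also have "\<dots> \<le> 1" using assms by (intro power_le_one) (auto simp: power_le_one)
  also have "1 \<le> 1 + ?y ^ 3" using y by simp
  also have "\<dots> = (1 - ?y + ?y\<^sup>2) * (1 + ?y)" by (simp add: algebra_simps power2_eq_square power3_eq_cube)
  finally show ?thesis using y by (simp add: mult_le_cancel_right)
qed

section \<open>Clusters, measurability and graph isomorphisms\<close>

lemma joined_refl [simp]: "joined F x x"
  by (simp add: joined_def)

lemma joined_step: "{x, y} \<in> F \<Longrightarrow> joined F x y"
  by (auto simp: joined_def)

lemma joined_trans: "joined F x y \<Longrightarrow> joined F y z \<Longrightarrow> joined F x z"
  by (auto simp: joined_def)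

lemma joined_sym: "joined F x y \<Longrightarrow> joined F y x"
  unfolding joined_def
proof (induction rule: rtranclp_induct)
  case (step y z)
  then have "{z, y} \<in> F" by (simp add: insert_commute)
  then show ?case using step.IH by (rule converse_rtranclp_into_rtranclp)
qed simp

lemma joined_mono: "joined F x y \<Longrightarrow> F \<subseteq> F' \<Longrightarrow> joined F' x y"
  unfolding joined_def by (erule rtranclp_mono[THEN predicate2D, rotated]) auto

lemma joined_closed:
  assumes "joined F x y" "x \<in> C" "\<And>a b. a \<in> C \<Longrightarrow> {a, b} \<in> F \<Longrightarrow> b \<in> C"
  shows "y \<in> C"
  using assms(1,2) unfolding joined_def by (induction rule: rtranclp_induct) (use assms(3) in auto)

lemma joined_image:
  assumes "joined F x y" "\<And>e. e \<in> F \<Longrightarrow> \<phi> ` e \<in> F'"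
  shows "joined F' (\<phi> x) (\<phi> y)"
  using assms(1) unfolding joined_def
proof (induction rule: rtranclp_induct)
  case (step y z)
  from assms(2)[OF step.hyps(2)] have "{\<phi> y, \<phi> z} \<in> F'" by simp
  with step.IH show ?case by (rule rtranclp.rtrancl_into_rtrancl)
qed simp

lemma joined_finite_subset:
  assumes "joined F x y"
  shows "\<exists>F'\<subseteq>F. finite F' \<and> joined F' x y"
  using assms unfolding joined_def
proof (induction rule: rtranclp_induct)
  case base then show ?case by (intro exI[of _ "{}"]) auto
next
  case (step y z)
  then obtain F' where F': "F' \<subseteq> F" "finite F'" "joined F' x y" by (auto simp: joined_def)
  have "joined (insert {y, z} F') x z"
    using joined_mono[OF F'(3), of "insert {y, z} F'"] by (auto intro: joined_trans joined_step)
  then show ?case using F' step.hyps(2)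
    by (intro exI[of _ "insert {y, z} F'"]) (auto simp: joined_def)
qed

text \<open>
  This writes connectivity as a countable union of events on finitely many edges, when the graph is
  countable.
\<close>

lemma joined_open_iff:
  "joined (open_edges G \<omega>) v w \<longleftrightarrow>
     (\<exists>F\<in>{F. finite F \<and> F \<subseteq> edges G \<and> joined F v w}. \<forall>e\<in>F. \<omega> e)"
proof
  assume "joined (open_edges G \<omega>) v w"
  then obtain F where "F \<subseteq> open_edges G \<omega>" "finite F" "joined F v w"
    by (blast dest: joined_finite_subset)
  then show "\<exists>F\<in>{F. finite F \<and> F \<subseteq> edges G \<and> joined F v w}. \<forall>e\<in>F. \<omega> e"
    by (intro bexI[of _ F]) (auto simp: open_edges_def)
next
  assume "\<exists>F\<in>{F. finite F \<and> F \<subseteq> edges G \<and> joined F v w}. \<forall>e\<in>F. \<omega> e"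
  then show "joined (open_edges G \<omega>) v w" by (auto simp: open_edges_def intro: joined_mono)
qed

lemma sets_has_infinite_cluster:
  assumes "countable (verts G)" "countable (edges G)"
  shows "{\<omega> \<in> space (percolation G p). has_infinite_cluster G \<omega>} \<in> sets (percolation G p)"
proof -
  have inf: "infinite (cluster G \<omega> v) \<longleftrightarrow>
      (\<forall>B\<in>{B. finite B \<and> B \<subseteq> verts G}. \<exists>w\<in>verts G - B. joined (open_edges G \<omega>) v w)" for \<omega> v
  proof
    assume inf: "infinite (cluster G \<omega> v)"
    show "\<forall>B\<in>{B. finite B \<and> B \<subseteq> verts G}. \<exists>w\<in>verts G - B. joined (open_edges G \<omega>) v w"
    proof
      fix B assume "B \<in> {B. finite B \<and> B \<subseteq> verts G}"
      then have "\<not> cluster G \<omega> v \<subseteq> B" using inf finite_subset by auto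
      then show "\<exists>w\<in>verts G - B. joined (open_edges G \<omega>) v w" by (auto simp: cluster_def)
    qed
  next
    assume *: "\<forall>B\<in>{B. finite B \<and> B \<subseteq> verts G}. \<exists>w\<in>verts G - B. joined (open_edges G \<omega>) v w"
    show "infinite (cluster G \<omega> v)"
    proof
      assume "finite (cluster G \<omega> v)"
      with *[rule_format, of "cluster G \<omega> v"] show False by (auto simp: cluster_def)
    qed
  qed
  have single: "{\<omega> \<in> space (percolation G p). \<omega> e} \<in> sets (percolation G p)" if "e \<in> edges G" for e
    using that by (intro sets_depends_on[of "{e}"]) (auto simp: depends_on_def)
  show ?thesis
    unfolding has_infinite_cluster_def inf joined_open_iff
    by (intro sets.sets_Collect_countable_Ex' sets.sets_Collect_countable_All'
        single)
      (use assms in \<open>auto intro: countable_finite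
         countable_subset[OF _ countable_Collect_finite_subset[OF assms(2)]]
         countable_subset[OF _ countable_Collect_finite_subset[OF assms(1)]]\<close>)
qed

text \<open>
  Isomorphism of graphs, given by a map on the vertices only.
\<close>

definition graph_iso :: "('a \<Rightarrow> 'b) \<Rightarrow> 'a sgraph \<Rightarrow> 'b sgraph \<Rightarrow> bool" where
  "graph_iso \<phi> G H \<longleftrightarrow> edges G \<subseteq> Pow (verts G) \<and> bij_betw \<phi> (verts G) (verts H) \<and>
     edges H = (\<lambda>e. \<phi> ` e) ` edges G"

lemma has_infinite_cluster_iso:
  fixes \<phi> :: "'a \<Rightarrow> 'b"
  assumes iso: "graph_iso \<phi> G H"
  shows "has_infinite_cluster H \<omega> \<longleftrightarrow> has_infinite_cluster G (\<lambda>e\<in>edges G. \<omega> (\<phi> ` e))"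
proof -
  let ?T = "\<lambda>e\<in>edges G. \<omega> (\<phi> ` e)"
  have sub: "edges G \<subseteq> Pow (verts G)" and inj: "inj_on \<phi> (verts G)" and im: "\<phi> ` verts G = verts H"
    and E: "edges H = (\<lambda>e. \<phi> ` e) ` edges G"
    using iso by (auto simp: graph_iso_def bij_betw_def)
  let ?\<psi> = "inv_into (verts G) \<phi>"
  have j: "joined (open_edges H \<omega>) (\<phi> v) (\<phi> w) \<longleftrightarrow> joined (open_edges G ?T) v w"
    if "v \<in> verts G" "w \<in> verts G" for v w
  proof
    assume "joined (open_edges H \<omega>) (\<phi> v) (\<phi> w)"
    then have "joined (open_edges G ?T) (?\<psi> (\<phi> v)) (?\<psi> (\<phi> w))"
    proof (rule joined_image)
      fix e assume "e \<in> open_edges H \<omega>"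
      then obtain e' where e': "e' \<in> edges G" "e = \<phi> ` e'" "\<omega> e" by (auto simp: open_edges_def E)
      then have "?\<psi> ` e = e'" using sub inj by (simp add: inv_into_image_cancel subset_eq)
      then show "?\<psi> ` e \<in> open_edges G ?T" using e' by (auto simp: open_edges_def)
    qed
    then show "joined (open_edges G ?T) v w" using inj that by simp
  next
    assume "joined (open_edges G ?T) v w"
    then show "joined (open_edges H \<omega>) (\<phi> v) (\<phi> w)"
      by (rule joined_image) (auto simp: open_edges_def E)
  qed
  have "cluster H \<omega> (\<phi> v) = \<phi> ` cluster G ?T v" if "v \<in> verts G" for v
    using j[OF that] unfolding cluster_def im[symmetric] by auto
  moreover have "inj_on \<phi> (cluster G ?T v)" for v
    by (rule inj_on_subset[OF inj]) (auto simp: cluster_def)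
  ultimately show ?thesis
    unfolding has_infinite_cluster_def im[symmetric] by (auto simp: finite_image_iff)
qed

lemma prb_has_infinite_cluster_iso:
  fixes \<phi> :: "'a \<Rightarrow> 'b"
  assumes iso: "graph_iso \<phi> G H" and "countable (verts G)" "countable (edges G)"
  shows "prb H p (has_infinite_cluster H) = prb G p (has_infinite_cluster G)"
proof -
  have "inj_on (\<lambda>e. \<phi> ` e) (edges G)"
    using iso unfolding graph_iso_def bij_betw_def by (meson inj_on_image_Pow inj_on_subset)
  then have "prb H p (\<lambda>\<omega>. has_infinite_cluster G (\<lambda>e\<in>edges G. \<omega> (\<phi> ` e))) = prb G p (has_infinite_cluster G)"
    using iso by (intro prb_reindex sets_has_infinite_cluster assms) (auto simp: graph_iso_def)
  then show ?thesis by (simp add: has_infinite_cluster_iso[OF iso, abs_def])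
qed

lemma critical_prob_prb:
  "critical_prob G = Inf {p. 0 \<le> p \<and> p \<le> 1 \<and> prb G p (has_infinite_cluster G) = 1}"
  by (simp add: critical_prob_def prb_def)

lemma AE_no_infinite_cluster:
  assumes "countable (verts G)" "countable (edges G)" "prb G p (has_infinite_cluster G) = 0"
  shows "AE \<omega> in percolation G p. \<not> has_infinite_cluster G \<omega>"
proof -
  interpret prob_space "percolation G p" by (rule prob_space_percolation)
  show ?thesis
    using assms(3) prob_Collect_eq_0[OF sets_has_infinite_cluster[OF assms(1,2)]]
    by (simp add: prb_def)
qed

section \<open>The lamp graph\<close>

text \<open>
  The lamp graph with \<open>\<alpha>\<close> lamp states, which is the positive part of a lamplighter graph.
\<close>

locale lamplighter =
  fixes \<alpha> :: nat
  assumes two_le: "2 \<le> \<alpha>"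
begin

text \<open>
  The edge that goes up from \<open>(k, f)\<close>, setting lamp \<open>k\<close> to \<open>a\<close>.
\<close>

definition lamp_edge :: "nat \<Rightarrow> (nat \<Rightarrow> nat) \<Rightarrow> nat \<Rightarrow> (nat \<times> (nat \<Rightarrow> nat)) set" where
  "lamp_edge k f a = {(k, f), (Suc k, f(k := a))}"

text \<open>
  Lamp configurations of finite support.
\<close>

definition lamps :: "(nat \<Rightarrow> nat) set" where
  "lamps = {f. (\<forall>i. f i < \<alpha>) \<and> finite {i. f i \<noteq> 0}}"

text \<open>
  Lamp configurations in which all lamps from \<open>n\<close> on are off.
\<close>

definition lamps_below :: "nat \<Rightarrow> (nat \<Rightarrow> nat) set" where
  "lamps_below n = {f. (\<forall>i. f i < \<alpha>) \<and> (\<forall>i\<ge>n. f i = 0)}"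

text \<open>
  The lamp graph. Setting lamp \<open>k\<close> to its present state is allowed, so \<open>(k, f)\<close> and \<open>(k + 1, f)\<close> are
  adjacent.
\<close>

definition lamp_graph :: "(nat \<times> (nat \<Rightarrow> nat)) sgraph" where
  "lamp_graph = \<lparr>verts = UNIV \<times> lamps, edges = {lamp_edge k f a | k f a. f \<in> lamps \<and> a < \<alpha>}\<rparr>"

definition origin :: "nat \<times> (nat \<Rightarrow> nat)" where
  "origin = (0, \<lambda>_. 0)"

text \<open>
  The edges between levels \<open>0, \<dots>, n\<close> whose lamps from \<open>n\<close> on are off. This is the part of these
  levels that is connected to the origin.
\<close>

definition lamp_box :: "nat \<Rightarrow> (nat \<times> (nat \<Rightarrow> nat)) set set" where
  "lamp_box n = {lamp_edge k f a | k f a. k < n \<and> f \<in> lamps_below n \<and> a < \<alpha>}"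

text \<open>
  The vertices joined to the origin by open edges of a box.
\<close>

definition box_cluster :: "nat \<Rightarrow> ((nat \<times> (nat \<Rightarrow> nat)) set \<Rightarrow> bool) \<Rightarrow> (nat \<times> (nat \<Rightarrow> nat)) set" where
  "box_cluster n \<omega> = {w. joined {e \<in> lamp_box n. \<omega> e} origin w}"

text \<open>
  The random set called \<open>S\<^sub>n\<close> above.
\<close>

definition reach :: "nat \<Rightarrow> ((nat \<times> (nat \<Rightarrow> nat)) set \<Rightarrow> bool) \<Rightarrow> (nat \<times> (nat \<Rightarrow> nat)) set" where
  "reach n \<omega> = {w \<in> box_cluster n \<omega>. fst w = n}"

lemma alpha_pos: "0 < \<alpha>" using two_le by simp

lemma verts_lamp_graph: "verts lamp_graph = UNIV \<times> lamps" by (simp add: lamp_graph_def)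

lemma edges_lamp_graph: "edges lamp_graph = {lamp_edge k f a | k f a. f \<in> lamps \<and> a < \<alpha>}" by (simp add: lamp_graph_def)

lemma lamps_upd: "f \<in> lamps \<Longrightarrow> a < \<alpha> \<Longrightarrow> f(k := a) \<in> lamps"
proof -
  assume *: "f \<in> lamps" "a < \<alpha>"
  then have "finite (insert k {i. f i \<noteq> 0})" by (simp add: lamps_def)
  then have "finite {i. (f(k := a)) i \<noteq> 0}" by (rule rev_finite_subset) auto
  then show ?thesis using * by (simp add: lamps_def)
qed

lemma lamps_below_upd: "f \<in> lamps_below n \<Longrightarrow> a < \<alpha> \<Longrightarrow> k < n \<Longrightarrow> f(k := a) \<in> lamps_below n"
  unfolding lamps_below_def by auto

lemma lamps_below_subset: "lamps_below n \<subseteq> lamps"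
proof
  fix f assume f: "f \<in> lamps_below n"
  have "{i. f i \<noteq> 0} \<subseteq> {..<n}"
    using f by (auto simp: lamps_below_def) (metis not_le less_nat_zero_code)
  then have "finite {i. f i \<noteq> 0}" by (rule finite_subset) simp
  then show "f \<in> lamps" using f by (simp add: lamps_below_def lamps_def)
qed

lemma lamps_below_mono: "n \<le> m \<Longrightarrow> lamps_below n \<subseteq> lamps_below m"
  unfolding lamps_below_def by auto

lemma finite_lamps_below: "finite (lamps_below n)"
proof (rule finite_subset)
  show "lamps_below n \<subseteq> {f. \<forall>i. (i \<in> {..<n} \<longrightarrow> f i \<in> {..<\<alpha>}) \<and> (i \<notin> {..<n} \<longrightarrow> f i = 0)}"
    unfolding lamps_below_def by auto
  show "finite \<dots>" by (rule finite_set_of_finite_funs) auto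
qed

lemma lamps_eq_Union: "lamps = (\<Union>n. lamps_below n)"
proof (intro equalityI subsetI)
  fix f assume f: "f \<in> lamps"
  then obtain n where "\<forall>i\<in>{i. f i \<noteq> 0}. i < n"
    unfolding lamps_def using finite_nat_set_iff_bounded by auto
  then have "\<forall>i\<ge>n. f i = 0" by (auto simp: not_less[symmetric])
  then show "f \<in> (\<Union>n. lamps_below n)" using f by (auto simp: lamps_below_def lamps_def)
qed (use lamps_below_subset in auto)

lemma countable_verts_lamp_graph: "countable (verts lamp_graph)"
  unfolding verts_lamp_graph lamps_eq_Union using finite_lamps_below by (auto intro: countable_finite)

lemma edges_lamp_graph_subset: "edges lamp_graph \<subseteq> Pow (verts lamp_graph)"
  unfolding edges_lamp_graph verts_lamp_graph lamp_edge_def by (auto intro: lamps_upd)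

lemma countable_edges_lamp_graph: "countable (edges lamp_graph)"
proof (rule countable_subset)
  show "edges lamp_graph \<subseteq> {e. finite e \<and> e \<subseteq> verts lamp_graph}"
    using edges_lamp_graph_subset by (auto simp: edges_lamp_graph lamp_edge_def)
  show "countable \<dots>" by (rule countable_Collect_finite_subset[OF countable_verts_lamp_graph])
qed

lemma lamp_box_subset: "lamp_box n \<subseteq> edges lamp_graph"
  unfolding lamp_box_def edges_lamp_graph using lamps_below_subset by blast

lemma lamp_box_mono: "n \<le> m \<Longrightarrow> lamp_box n \<subseteq> lamp_box m"
  unfolding lamp_box_def using lamps_below_mono[of n m] by fastforce

lemma finite_lamp_box: "finite (lamp_box n)"
proof (rule finite_subset)
  show "lamp_box n \<subseteq> (\<lambda>(k, f, a). lamp_edge k f a) ` ({..<n} \<times> lamps_below n \<times> {..<\<alpha>})"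
    unfolding lamp_box_def by auto
qed (simp add: finite_lamps_below)

lemma lamp_edge_cases:
  assumes "{(j, g), y} = lamp_edge k f a"
  obtains (up) "j = k" "g = f" "y = (Suc k, f(k := a))"
    | (down) "j = Suc k" "g = f(k := a)" "y = (k, g(k := f k))"
  using assms unfolding lamp_edge_def doubleton_eq_iff by auto

lemma finite_box_vertices: "finite ({..n} \<times> lamps_below n)"
  using finite_lamps_below by simp

lemma origin_in: "origin \<in> {..n} \<times> lamps_below n"
  using alpha_pos by (auto simp: origin_def lamps_below_def)

lemma box_cluster_subset: "box_cluster n \<omega> \<subseteq> {..n} \<times> lamps_below n"
proof
  fix w assume "w \<in> box_cluster n \<omega>"
  then have "joined {e \<in> lamp_box n. \<omega> e} origin w" by (simp add: box_cluster_def)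
  then show "w \<in> {..n} \<times> lamps_below n"
  proof (rule joined_closed[OF _ origin_in])
    fix x y assume x: "x \<in> {..n} \<times> lamps_below n" and "{x, y} \<in> {e \<in> lamp_box n. \<omega> e}"
    then obtain k f a where k: "{x, y} = lamp_edge k f a" "k < n" "f \<in> lamps_below n" "a < \<alpha>"
      by (auto simp: lamp_box_def)
    then have "y \<in> lamp_edge k f a" by blast
    then show "y \<in> {..n} \<times> lamps_below n"
      using k lamps_below_upd by (auto simp: lamp_edge_def)
  qed
qed

lemma reach_subset: "reach n \<omega> \<subseteq> {n} \<times> lamps_below n"
  using box_cluster_subset[of n \<omega>] by (auto simp: reach_def)

lemma finite_top_level: "finite ({n} \<times> lamps_below n)"
  using finite_lamps_below by simp

lemma finite_reach: "finite (reach n \<omega>)"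
  using finite_subset[OF reach_subset finite_top_level] .

text \<open>
  An open path can leave the cluster of the origin within a box only through an edge that goes up from
  the top level.
\<close>

lemma box_cluster_step:
  assumes w: "w \<in> box_cluster n \<omega>" and e: "{w, w'} \<in> edges lamp_graph" "\<omega> {w, w'}"
  shows "w' \<in> box_cluster n \<omega> \<or>
    (\<exists>g a. w = (n, g) \<and> a < \<alpha> \<and> {w, w'} = lamp_edge n g a)"
proof -
  obtain j g where jg: "w = (j, g)" "j \<le> n" "g \<in> lamps_below n"
    using w box_cluster_subset[of n \<omega>] by (cases w) auto
  obtain k f a where k: "{w, w'} = lamp_edge k f a" "f \<in> lamps" "a < \<alpha>"
    using e(1) by (auto simp: edges_lamp_graph)
  have in_box: ?thesis if "{w, w'} \<in> lamp_box n"
    using w that e(2) by (auto simp: box_cluster_def intro: joined_trans joined_step)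
  from k(1)[unfolded jg(1)] show ?thesis
  proof (cases rule: lamp_edge_cases)
    case up
    show ?thesis
    proof (cases "k = n")
      case True then show ?thesis using up k jg by auto
    next
      case False
      then have "k < n" "f \<in> lamps_below n" using up jg by auto
      then have "{w, w'} \<in> lamp_box n" unfolding lamp_box_def using k by blast
      then show ?thesis using in_box jg by simp
    qed
  next
    case down
    have "f = g(k := f k)" using down by auto
    moreover have "f k < \<alpha>" using k(2) by (auto simp: lamps_def)
    ultimately have "f \<in> lamps_below n" using jg down lamps_below_upd[of g n "f k" k] by simp
    moreover have "k < n" using down jg by simp
    ultimately have "{w, w'} \<in> lamp_box n" unfolding lamp_box_def using k by blast
    then show ?thesis using in_box jg by simp
  qed
qed

lemma infinite_cluster_reach:
  assumes "infinite (cluster lamp_graph \<omega> origin)"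
  shows "reach n \<omega> \<noteq> {}"
proof
  assume empty: "reach n \<omega> = {}"
  have "cluster lamp_graph \<omega> origin \<subseteq> box_cluster n \<omega>"
  proof
    fix w assume "w \<in> cluster lamp_graph \<omega> origin"
    then have "joined (open_edges lamp_graph \<omega>) origin w" by (simp add: cluster_def)
    then show "w \<in> box_cluster n \<omega>"
    proof (rule joined_closed)
      show "origin \<in> box_cluster n \<omega>" by (simp add: box_cluster_def)
      fix x y assume x: "x \<in> box_cluster n \<omega>" and "{x, y} \<in> open_edges lamp_graph \<omega>"
      then have "{x, y} \<in> edges lamp_graph" "\<omega> {x, y}" by (auto simp: open_edges_def)
      from box_cluster_step[OF x this] show "y \<in> box_cluster n \<omega>"
        using x empty by (auto simp: reach_def)
    qed
  qed
  then show False
    using assms finite_subset finite_subset[OF box_cluster_subset finite_box_vertices] by blast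
qed

text \<open>
  All edges that go up from vertices in \<open>S\<close>.
\<close>

definition up_edges :: "(nat \<times> (nat \<Rightarrow> nat)) set \<Rightarrow> (nat \<times> (nat \<Rightarrow> nat)) set set" where
  "up_edges S = (\<lambda>((n, g), a). lamp_edge n g a) ` (S \<times> {..<\<alpha>})"

lemma reach_Suc_empty:
  assumes "\<forall>e\<in>up_edges (reach n \<omega>). \<not> \<omega> e"
  shows "reach (Suc n) \<omega> = {}"
proof -
  have "box_cluster (Suc n) \<omega> \<subseteq> box_cluster n \<omega>"
  proof
    fix w assume "w \<in> box_cluster (Suc n) \<omega>"
    then have "joined {e \<in> lamp_box (Suc n). \<omega> e} origin w" by (simp add: box_cluster_def)
    then show "w \<in> box_cluster n \<omega>"
    proof (rule joined_closed)
      show "origin \<in> box_cluster n \<omega>" by (simp add: box_cluster_def)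
      fix x y assume x: "x \<in> box_cluster n \<omega>" and "{x, y} \<in> {e \<in> lamp_box (Suc n). \<omega> e}"
      then have e: "{x, y} \<in> edges lamp_graph" "\<omega> {x, y}" using lamp_box_subset by auto
      show "y \<in> box_cluster n \<omega>"
      proof (rule ccontr)
        assume "y \<notin> box_cluster n \<omega>"
        then obtain g a where g: "x = (n, g)" "a < \<alpha>" "{x, y} = lamp_edge n g a"
          using box_cluster_step[OF x e] by blast
        then have "{x, y} \<in> up_edges (reach n \<omega>)"
          using x by (auto simp: up_edges_def reach_def intro!: image_eqI[of _ _ "((n, g), a)"])
        then show False using assms e by blast
      qed
    qed
  qed
  then show ?thesis using box_cluster_subset[of n \<omega>] unfolding reach_def by fastforce
qed

lemma reach_empty_mono:
  assumes "reach n \<omega> = {}" "n \<le> m"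
  shows "reach m \<omega> = {}"
  using assms(2)
proof (induction rule: dec_induct)
  case base show ?case by (rule assms(1))
next
  case (step k) then show ?case by (intro reach_Suc_empty) (simp add: up_edges_def)
qed

lemma depends_on_reach: "depends_on (lamp_box n) (\<lambda>\<omega>. P (reach n \<omega>))"
proof -
  have "reach n \<omega> = reach n \<omega>'" if "\<forall>e\<in>lamp_box n. \<omega> e = \<omega>' e" for \<omega> \<omega>'
  proof -
    have "{e \<in> lamp_box n. \<omega> e} = {e \<in> lamp_box n. \<omega>' e}" using that by auto
    then show ?thesis by (simp add: reach_def box_cluster_def)
  qed
  then show ?thesis unfolding depends_on_def by metis
qed

lemma finite_up_edges: "finite S \<Longrightarrow> finite (up_edges S)"
  by (simp add: up_edges_def)

lemma card_up_edges: "finite S \<Longrightarrow> card (up_edges S) \<le> card S * \<alpha>"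
  unfolding up_edges_def by (rule order_trans[OF card_image_le]) (auto simp: card_cartesian_product)

lemma up_edges_subset: "S \<subseteq> {n} \<times> lamps_below n \<Longrightarrow> up_edges S \<subseteq> edges lamp_graph"
  using lamps_below_subset[of n] by (fastforce simp: up_edges_def edges_lamp_graph)

lemma up_edges_box_disjoint: "S \<subseteq> {n} \<times> lamps_below n \<Longrightarrow> lamp_box n \<inter> up_edges S = {}"
  by (auto simp: up_edges_def lamp_box_def lamp_edge_def doubleton_eq_iff)

text \<open>
  The embedding of the lamp graph into itself that takes the origin to \<open>v = (k, f)\<close>: levels are
  raised by \<open>k\<close>, the lamps below \<open>k\<close> agree with \<open>f\<close>, and the lamps of the argument are moved up by
  \<open>k\<close> places and added to \<open>f\<close> modulo \<open>\<alpha>\<close>.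
\<close>

fun shift :: "nat \<times> (nat \<Rightarrow> nat) \<Rightarrow> nat \<times> (nat \<Rightarrow> nat) \<Rightarrow> nat \<times> (nat \<Rightarrow> nat)" where
  "shift (k, f) (j, g) = (k + j, \<lambda>i. if i < k then f i else (g (i - k) + f i) mod \<alpha>)"

lemma shift_origin: "v \<in> verts lamp_graph \<Longrightarrow> shift v origin = v"
  by (cases v) (auto simp: verts_lamp_graph lamps_def origin_def)

lemma shift_lamp_edge:
  "shift (k, f) ` lamp_edge j g a
   = lamp_edge (k + j) (snd (shift (k, f) (j, g))) ((a + f (k + j)) mod \<alpha>)"
proof -
  have "shift (k, f) (Suc j, g(j := a)) = (Suc (k + j), (snd (shift (k, f) (j, g)))(k + j := (a + f (k + j)) mod \<alpha>))"
    by (auto simp: fun_eq_iff)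
  moreover have "shift (k, f) (j, g) = (k + j, snd (shift (k, f) (j, g)))" by simp
  ultimately show ?thesis unfolding lamp_edge_def by (simp only: image_insert image_empty)
qed

lemma shift_lamps:
  assumes "f \<in> lamps" "g \<in> lamps"
  shows "snd (shift (k, f) (j, g)) \<in> lamps"
proof -
  have "{i. snd (shift (k, f) (j, g)) i \<noteq> 0} \<subseteq> {..<k} \<union> (\<lambda>i. i + k) ` {i. g i \<noteq> 0} \<union> {i. f i \<noteq> 0}"
  proof
    fix i assume i: "i \<in> {i. snd (shift (k, f) (j, g)) i \<noteq> 0}"
    then have "i < k \<or> f i \<noteq> 0 \<or> g (i - k) \<noteq> 0"
      by (cases "f i = 0"; cases "g (i - k) = 0") (simp_all split: if_splits)
    moreover have "i \<in> (\<lambda>i. i + k) ` {i. g i \<noteq> 0}" if "\<not> i < k" "g (i - k) \<noteq> 0"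
      using that by (intro image_eqI[of _ _ "i - k"]) auto
    ultimately show "i \<in> {..<k} \<union> (\<lambda>i. i + k) ` {i. g i \<noteq> 0} \<union> {i. f i \<noteq> 0}" by blast
  qed
  then have "finite {i. snd (shift (k, f) (j, g)) i \<noteq> 0}"
    using assms by (rule_tac finite_subset) (auto simp: lamps_def)
  then show ?thesis using assms alpha_pos by (auto simp: lamps_def)
qed

lemma shift_edges: "v \<in> verts lamp_graph \<Longrightarrow> e \<in> edges lamp_graph \<Longrightarrow> shift v ` e \<in> edges lamp_graph"
proof -
  assume v: "v \<in> verts lamp_graph" and "e \<in> edges lamp_graph"
  then obtain j g a where e: "e = lamp_edge j g a" "g \<in> lamps" "a < \<alpha>" by (auto simp: edges_lamp_graph)
  obtain k f where kf: "v = (k, f)" "f \<in> lamps" using v by (auto simp: verts_lamp_graph)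
  show "shift v ` e \<in> edges lamp_graph"
    unfolding e(1) kf(1) shift_lamp_edge edges_lamp_graph
    using shift_lamps[OF kf(2) e(2), of k j] alpha_pos by (blast intro: mod_less_divisor)
qed

lemma mod_add_cancel: "(a + c) mod \<alpha> = (b + c) mod \<alpha> \<Longrightarrow> a < \<alpha> \<Longrightarrow> b < \<alpha> \<Longrightarrow> a = b"
proof -
  assume *: "(a + c) mod \<alpha> = (b + c) mod \<alpha>" "a < \<alpha>" "b < \<alpha>"
  then have "a mod \<alpha> = b mod \<alpha>"
    using cong_add_rcancel_nat[of a c b \<alpha>] by (simp add: cong_def)
  then show "a = b" using * by simp
qed

lemma inj_on_shift: "inj_on (shift v) (verts lamp_graph)"
proof (rule inj_onI)
  fix x y assume xy: "x \<in> verts lamp_graph" "y \<in> verts lamp_graph" "shift v x = shift v y"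
  obtain k f j g j' g' where v: "v = (k, f)" "x = (j, g)" "y = (j', g')" by (cases v, cases x, cases y)
  have "j = j'" using xy v by simp
  moreover have "g i = g' i" for i
  proof -
    have "snd (shift v x) (i + k) = snd (shift v y) (i + k)" using xy by simp
    then have "(g i + f (i + k)) mod \<alpha> = (g' i + f (i + k)) mod \<alpha>" by (simp add: v)
    moreover have "g i < \<alpha>" "g' i < \<alpha>" using xy v by (auto simp: verts_lamp_graph lamps_def)
    ultimately show ?thesis by (rule mod_add_cancel)
  qed
  ultimately show "x = y" using v by auto
qed

lemma inj_on_shift_edges: "inj_on (\<lambda>e. shift v ` e) (edges lamp_graph)"
  using inj_on_image_Pow[OF inj_on_shift] edges_lamp_graph_subset by (rule inj_on_subset)

lemma shift_box:
  assumes "g \<in> lamps_below n" "e \<in> lamp_box m"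
  shows "shift (n, g) ` e \<in> lamp_box (n + m)"
proof -
  obtain k f a where e: "e = lamp_edge k f a" "k < m" "f \<in> lamps_below m" "a < \<alpha>"
    using assms(2) by (auto simp: lamp_box_def)
  have "snd (shift (n, g) (k, f)) \<in> lamps_below (n + m)"
    using assms(1) e(3) alpha_pos by (auto simp: lamps_below_def)
  moreover have "(a + g (n + k)) mod \<alpha> < \<alpha>" "n + k < n + m" using alpha_pos e(2) by auto
  ultimately show ?thesis unfolding e(1) shift_lamp_edge lamp_box_def by blast
qed

text \<open>
  The configuration seen from \<open>v\<close> in the copy of the lamp graph that starts at \<open>v\<close>.
\<close>

definition pull :: "nat \<times> (nat \<Rightarrow> nat) \<Rightarrow> ((nat \<times> (nat \<Rightarrow> nat)) set \<Rightarrow> bool) \<Rightarrow> ((nat \<times> (nat \<Rightarrow> nat)) set \<Rightarrow> bool)" where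
  "pull v \<omega> = (\<lambda>e\<in>edges lamp_graph. \<omega> (shift v ` e))"

lemma pull_box: "e \<in> lamp_box m \<Longrightarrow> pull v \<omega> e = \<omega> (shift v ` e)"
  using lamp_box_subset by (auto simp: pull_def)

text \<open>
  The image of a box in the copy that starts at \<open>v\<close>.
\<close>

definition copy_box :: "nat \<times> (nat \<Rightarrow> nat) \<Rightarrow> nat \<Rightarrow> (nat \<times> (nat \<Rightarrow> nat)) set set" where
  "copy_box v m = (\<lambda>e. shift v ` e) ` lamp_box m"

lemma finite_copy_box: "finite (copy_box v m)"
  by (simp add: copy_box_def finite_lamp_box)

lemma copy_box_subset: "v \<in> verts lamp_graph \<Longrightarrow> copy_box v m \<subseteq> edges lamp_graph"
  using lamp_box_subset shift_edges unfolding copy_box_def by blast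

lemma depends_on_pull: "depends_on (copy_box v m) (\<lambda>\<omega>. P (reach m (pull v \<omega>)))"
proof -
  have "P (reach m (pull v \<omega>)) = P (reach m (pull v \<omega>'))" if "\<forall>e\<in>copy_box v m. \<omega> e = \<omega>' e" for \<omega> \<omega>'
    using that lamp_box_subset
    by (intro depends_on_reach[of m P, unfolded depends_on_def, rule_format])
      (auto simp: pull_def copy_box_def)
  then show ?thesis unfolding depends_on_def by blast
qed

lemma prb_pull:
  assumes "v \<in> verts lamp_graph"
  shows "prb lamp_graph p (\<lambda>\<omega>. P (reach m (pull v \<omega>))) = prb lamp_graph p (\<lambda>\<omega>. P (reach m \<omega>))"
  unfolding pull_def
  by (rule prb_reindex[OF inj_on_shift_edges _ sets_depends_on[OF finite_lamp_box lamp_box_subset depends_on_reach]])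
    (use shift_edges[OF assms] in auto)

text \<open>
  Copies starting at \<open>(k, f)\<close> and \<open>(k', f')\<close> are disjoint as soon as \<open>f\<close> and \<open>f'\<close> differ at a lamp
  below both levels, since that lamp is never switched again.
\<close>

lemma copy_box_disjoint:
  assumes "i < k" "i < k'" "f i \<noteq> f' i"
  shows "copy_box (k, f) m \<inter> copy_box (k', f') m' = {}"
proof -
  have "False" if "e \<in> copy_box (k, f) m" "e \<in> copy_box (k', f') m'" for e
  proof -
    have 1: "\<exists>x. x \<in> e" using that(1) by (force simp: copy_box_def lamp_box_def lamp_edge_def)
    have 2: "snd x i = f i" if "x \<in> e" for x
      using \<open>e \<in> copy_box (k, f) m\<close> that assms by (auto simp: copy_box_def)
    have 3: "snd x i = f' i" if "x \<in> e" for x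
      using \<open>e \<in> copy_box (k', f') m'\<close> that assms by (auto simp: copy_box_def)
    show False using 1 2 3 assms(3) by auto
  qed
  then show ?thesis by blast
qed

lemma copy_box_disjoint_box: "lamp_box n \<inter> copy_box (n, f) m = {}"
proof -
  have "False" if "e \<in> copy_box (n, f) m" "e \<in> lamp_box n" for e
  proof -
    have "\<exists>x\<in>e. fst x < n" using that(2) by (auto simp: lamp_box_def lamp_edge_def)
    moreover have "fst x \<ge> n" if "x \<in> e" for x
      using \<open>e \<in> copy_box (n, f) m\<close> that by (auto simp: copy_box_def)
    ultimately show False by force
  qed
  then show ?thesis by blast
qed

lemma reach_compose:
  assumes "w \<in> reach n \<omega>" "w' \<in> reach m (pull w \<omega>)"
  shows "shift w w' \<in> reach (n + m) \<omega>"
proof -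
  obtain g where w: "w = (n, g)" "g \<in> lamps_below n" using assms(1) reach_subset by blast
  have wV: "w \<in> verts lamp_graph" using w lamps_below_subset by (auto simp: verts_lamp_graph)
  have 1: "joined {e \<in> lamp_box (n + m). \<omega> e} origin w"
    using assms(1) lamp_box_mono[of n "n + m"] by (auto simp: reach_def box_cluster_def intro: joined_mono)
  have "joined {e \<in> lamp_box (n + m). \<omega> e} (shift w origin) (shift w w')"
  proof (rule joined_image[where \<phi> = "shift w"])
    show "joined {e \<in> lamp_box m. pull w \<omega> e} origin w'" using assms(2) by (simp add: reach_def box_cluster_def)
    show "shift w ` e \<in> {e \<in> lamp_box (n + m). \<omega> e}" if "e \<in> {e \<in> lamp_box m. pull w \<omega> e}" for e
      using that shift_box[OF w(2)] w(1) by (auto simp: pull_box)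
  qed
  then have "joined {e \<in> lamp_box (n + m). \<omega> e} origin (shift w w')"
    using 1 shift_origin[OF wV] by (auto intro: joined_trans)
  moreover have "fst w' = m" using assms(2) by (simp add: reach_def)
  ultimately show ?thesis by (cases w') (auto simp: reach_def box_cluster_def w(1))
qed

lemma pull_reach_cluster:
  assumes v: "v \<in> verts lamp_graph" and w: "w \<in> reach m (pull v \<omega>)"
  shows "shift v w \<in> cluster lamp_graph \<omega> v" "fst (shift v w) = fst v + m"
proof -
  have "joined {e \<in> lamp_box m. pull v \<omega> e} origin w" using w by (simp add: reach_def box_cluster_def)
  then have "joined (open_edges lamp_graph \<omega>) (shift v origin) (shift v w)"
    by (rule joined_image[where \<phi> = "shift v"])
      (use shift_edges[OF v] subsetD[OF lamp_box_subset] in \<open>auto simp: pull_box open_edges_def\<close>)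
  moreover have "shift v w \<in> verts lamp_graph"
  proof -
    obtain g where "w = (m, g)" "g \<in> lamps_below m" using w reach_subset by blast
    moreover obtain k f where "v = (k, f)" by (cases v)
    ultimately show ?thesis using shift_lamps[of f g k m] v lamps_below_subset by (auto simp: verts_lamp_graph)
  qed
  ultimately show "shift v w \<in> cluster lamp_graph \<omega> v" using shift_origin[OF v] by (simp add: cluster_def)
  show "fst (shift v w) = fst v + m" using w by (cases v; cases w) (auto simp: reach_def)
qed

lemma connected_lamp_graph:
  assumes "v \<in> verts lamp_graph"
  shows "joined (edges lamp_graph) origin v"
proof -
  obtain k f where v: "v = (k, f)" "f \<in> lamps" using assms by (auto simp: verts_lamp_graph)
  obtain n where n: "f \<in> lamps_below n" using v lamps_eq_Union by auto
  define N where "N = max n k"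
  have fN: "f \<in> lamps_below N" using n lamps_below_mono[of n N] by (auto simp: N_def)
  have up: "joined (edges lamp_graph) origin (m, \<lambda>i. if i < m then f i else 0)" for m
  proof (induction m)
    case 0 then show ?case by (simp add: origin_def)
  next
    case (Suc m)
    let ?g = "\<lambda>i. if i < m then f i else 0"
    have "finite {i. ?g i \<noteq> 0}" by (rule finite_subset[of _ "{..<m}"]) auto
    then have "?g \<in> lamps" using v(2) alpha_pos by (simp add: lamps_def)
    moreover have "f m < \<alpha>" using v(2) by (simp add: lamps_def)
    moreover have "(\<lambda>i. if i < Suc m then f i else 0) = ?g(m := f m)" by (auto simp: fun_eq_iff less_Suc_eq)
    ultimately have "{(m, ?g), (Suc m, \<lambda>i. if i < Suc m then f i else 0)} \<in> edges lamp_graph"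
      by (auto simp: edges_lamp_graph lamp_edge_def)
    then show ?case using Suc by (blast intro: joined_trans joined_step)
  qed
  have step: "{(m, f), (Suc m, f)} \<in> edges lamp_graph" for m
  proof -
    have "{(m, f), (Suc m, f)} = lamp_edge m f (f m)" by (simp add: lamp_edge_def)
    moreover have "f m < \<alpha>" using v(2) by (simp add: lamps_def)
    ultimately show ?thesis using v(2) unfolding edges_lamp_graph by blast
  qed
  have "joined (edges lamp_graph) (k, f) (k + m, f)" for m
    by (induction m) (auto intro: joined_trans joined_step[OF step])
  from this[of "N - k"] have "joined (edges lamp_graph) (k, f) (N, f)" by (simp add: N_def)
  moreover have "(\<lambda>i. if i < N then f i else 0) = f" using fN by (auto simp: lamps_below_def)
  ultimately show ?thesis using up[of N] v by (auto intro: joined_trans joined_sym)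
qed

section \<open>Branching inequalities\<close>

text \<open>
  The possible values of \<open>reach n\<close>.
\<close>

definition level_sets :: "nat \<Rightarrow> (nat \<times> (nat \<Rightarrow> nat)) set set" where
  "level_sets n = Pow ({n} \<times> lamps_below n)"

text \<open>
  The probability that level \<open>n\<close> is reached from the origin.
\<close>

definition reach_prob :: "real \<Rightarrow> nat \<Rightarrow> real" where
  "reach_prob p n = prb lamp_graph p (\<lambda>\<omega>. reach n \<omega> \<noteq> {})"

text \<open>
  The expected size of \<open>reach n\<close>, as a finite sum over its values.
\<close>

definition reach_exp :: "real \<Rightarrow> nat \<Rightarrow> real" where
  "reach_exp p n = (\<Sum>S\<in>level_sets n. card S * prb lamp_graph p (\<lambda>\<omega>. reach n \<omega> = S))"

lemma finite_level_sets: "finite (level_sets n)"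
  using finite_top_level by (simp add: level_sets_def)

lemma reach_in_level_sets: "reach n \<omega> \<in> level_sets n"
  using reach_subset by (simp add: level_sets_def)

lemma finite_level_set: "S \<in> level_sets n \<Longrightarrow> finite S"
  using finite_top_level finite_subset by (auto simp: level_sets_def)

lemma sets_reach: "{\<omega> \<in> space (percolation lamp_graph p). P (reach n \<omega>)} \<in> sets (percolation lamp_graph p)"
  by (rule sets_depends_on[OF finite_lamp_box lamp_box_subset depends_on_reach])

lemma prb_reach_empty: "prb lamp_graph p (\<lambda>\<omega>. reach n \<omega> = {}) = 1 - reach_prob p n"
  using prb_not[of lamp_graph p "\<lambda>\<omega>. reach n \<omega> = {}"] sets_reach[where P="\<lambda>R. R = {}"] by (simp add: reach_prob_def)

lemma reach_prob_bounds: "0 \<le> reach_prob p n" "reach_prob p n \<le> 1"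
  by (simp_all add: reach_prob_def)

lemma sum_reach: "(\<Sum>S\<in>level_sets n. prb lamp_graph p (\<lambda>\<omega>. reach n \<omega> = S)) = 1"
  using prb_total[OF finite_level_sets[of n] reach_in_level_sets, where Q = "\<lambda>_. True" and G = lamp_graph and p = p] sets_reach by (simp add: prb_True)

lemma prb_reach_empty_total:
  "prb lamp_graph p (\<lambda>\<omega>. reach m \<omega> = {})
   = (\<Sum>S\<in>level_sets n. prb lamp_graph p (\<lambda>\<omega>. reach n \<omega> = S \<and> reach m \<omega> = {}))"
  by (intro prb_total[OF finite_level_sets reach_in_level_sets]
      sets_depends_on[OF _ _ depends_on_conj[OF depends_on_reach depends_on_reach]])
    (use finite_lamp_box lamp_box_subset in auto)

lemma reach_prob_antimono: "n \<le> m \<Longrightarrow> reach_prob p m \<le> reach_prob p n"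
  unfolding reach_prob_def
  by (intro prb_mono sets_reach[where P = "\<lambda>R. R \<noteq> {}"]) (use reach_empty_mono in blast)

text \<open>
  The comparison with a branching process: given \<open>reach n \<omega> = S\<close>, level \<open>n + m\<close> can be missed only
  if each of the \<open>card S\<close> independent copies starting in \<open>S\<close> fails to reach its own level \<open>m\<close>.
\<close>

lemma reach_renewal:
  "1 - reach_prob p (n + m)
   \<le> (\<Sum>S\<in>level_sets n. prb lamp_graph p (\<lambda>\<omega>. reach n \<omega> = S) * (1 - reach_prob p m) ^ card S)"
proof -
  have "prb lamp_graph p (\<lambda>\<omega>. reach n \<omega> = S \<and> reach (n + m) \<omega> = {})
      \<le> prb lamp_graph p (\<lambda>\<omega>. reach n \<omega> = S) * (1 - reach_prob p m) ^ card S" if S: "S \<in> level_sets n" for S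
  proof -
    have fin: "finite S" using finite_level_set[OF S] .
    have sub: "S \<subseteq> {n} \<times> lamps_below n" using S by (simp add: level_sets_def)
    have SV: "w \<in> verts lamp_graph" if "w \<in> S" for w
      using that sub lamps_below_subset by (auto simp: verts_lamp_graph)
    let ?L = "\<Union>w\<in>S. copy_box w m"
    let ?R = "\<lambda>\<omega>. \<forall>w\<in>S. reach m (pull w \<omega>) = {}"
    have dep: "depends_on (copy_box w m) (\<lambda>\<omega>. reach m (pull w \<omega>) = {})" for w
      by (rule depends_on_pull)
    have L: "finite ?L" "?L \<subseteq> edges lamp_graph" "depends_on ?L ?R"
      subgoal using fin finite_copy_box by blast
      subgoal using copy_box_subset[OF SV] by blast
      subgoal by (intro depends_on_Ball dep)
      done
    have disj: "lamp_box n \<inter> ?L = {}" using sub copy_box_disjoint_box by blast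
    have disj2: "disjoint_family_on (\<lambda>w. copy_box w m) S"
      unfolding disjoint_family_on_def
    proof (intro ballI impI)
      fix w w' assume w: "w \<in> S" "w' \<in> S" "w \<noteq> w'"
      obtain g where g1: "w = (n, g)" "g \<in> lamps_below n" using w(1) sub by auto
      obtain g' where g2: "w' = (n, g')" "g' \<in> lamps_below n" using w(2) sub by auto
      note g = g1(1) g2(1) g1(2) g2(2)
      have "g \<noteq> g'" using w(3) g by simp
      then obtain i where i: "g i \<noteq> g' i" by auto
      have "i < n"
      proof (rule ccontr)
        assume "\<not> i < n"
        then show False using i g by (simp add: lamps_below_def)
      qed
      then show "copy_box w m \<inter> copy_box w' m = {}"
        unfolding g using i by (simp add: copy_box_disjoint[of i])
    qed
    have "prb lamp_graph p ?R = (\<Prod>w\<in>S. prb lamp_graph p (\<lambda>\<omega>. reach m (pull w \<omega>) = {}))"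
      by (rule prb_independent[OF fin finite_copy_box copy_box_subset[OF SV] disj2 dep])
    also have "\<dots> = (\<Prod>w\<in>S. 1 - reach_prob p m)"
      by (intro prod.cong refl) (simp add: prb_pull[OF SV, where P = "\<lambda>R. R = {}"] prb_reach_empty)
    finally have R: "prb lamp_graph p ?R = (1 - reach_prob p m) ^ card S" by simp
    have "prb lamp_graph p (\<lambda>\<omega>. reach n \<omega> = S \<and> reach (n + m) \<omega> = {}) \<le> prb lamp_graph p (\<lambda>\<omega>. reach n \<omega> = S \<and> ?R \<omega>)"
    proof (rule prb_mono)
      show "reach n \<omega> = S \<and> ?R \<omega>" if "reach n \<omega> = S \<and> reach (n + m) \<omega> = {}" for \<omega>
        using that reach_compose[of _ n \<omega> _ m] by blast
      show "{\<omega> \<in> space (percolation lamp_graph p). reach n \<omega> = S \<and> ?R \<omega>} \<in> sets (percolation lamp_graph p)"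
        by (intro sets_depends_on[OF _ _ depends_on_conj[OF depends_on_reach L(3)]])
          (use L finite_lamp_box lamp_box_subset in auto)
    qed
    also have "\<dots> = prb lamp_graph p (\<lambda>\<omega>. reach n \<omega> = S) * prb lamp_graph p ?R"
      by (intro prb_independent2[OF finite_lamp_box lamp_box_subset depends_on_reach L disj])
    finally show ?thesis by (simp add: R)
  qed
  then have "prb lamp_graph p (\<lambda>\<omega>. reach (n + m) \<omega> = {})
      \<le> (\<Sum>S\<in>level_sets n. prb lamp_graph p (\<lambda>\<omega>. reach n \<omega> = S) * (1 - reach_prob p m) ^ card S)"
    unfolding prb_reach_empty_total[of p "n + m" n] by (rule sum_mono)
  then show ?thesis by (simp add: prb_reach_empty)
qed

text \<open>
  Given \<open>reach n \<omega> = S\<close>, the cluster dies at once if the at most \<open>\<alpha> * card S\<close> edges going up from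
  \<open>S\<close> are all closed. These edges lie outside the box that determines \<open>reach n\<close>.
\<close>

lemma reach_extinction:
  assumes p: "0 \<le> p" "p \<le> 1"
  shows "(\<Sum>S\<in>level_sets n. prb lamp_graph p (\<lambda>\<omega>. reach n \<omega> = S) * ((1 - p) ^ \<alpha>) ^ card S)
    \<le> 1 - reach_prob p (Suc n)"
proof -
  have "prb lamp_graph p (\<lambda>\<omega>. reach n \<omega> = S) * ((1 - p) ^ \<alpha>) ^ card S
      \<le> prb lamp_graph p (\<lambda>\<omega>. reach n \<omega> = S \<and> reach (Suc n) \<omega> = {})" if S: "S \<in> level_sets n" for S
  proof -
    have fin: "finite S" using finite_level_set[OF S] .
    have sub: "S \<subseteq> {n} \<times> lamps_below n" using S by (simp add: level_sets_def)
    let ?R = "\<lambda>\<omega>. \<forall>e\<in>up_edges S. \<not> \<omega> e"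
    have dep: "depends_on (up_edges S) ?R" by (auto simp: depends_on_def)
    have "prb lamp_graph p (\<lambda>\<omega>. reach n \<omega> = S) * ((1 - p) ^ \<alpha>) ^ card S
        \<le> prb lamp_graph p (\<lambda>\<omega>. reach n \<omega> = S) * (1 - p) ^ card (up_edges S)"
      unfolding power_mult[symmetric] using card_up_edges[OF fin] p
      by (intro mult_left_mono power_decreasing) (auto simp: mult.commute)
    also have "\<dots> = prb lamp_graph p (\<lambda>\<omega>. reach n \<omega> = S \<and> ?R \<omega>)"
      using prb_independent2[OF finite_lamp_box lamp_box_subset depends_on_reach finite_up_edges[OF fin]
          up_edges_subset[OF sub] dep up_edges_box_disjoint[OF sub], of p "\<lambda>R. R = S"]
        prb_open(2)[OF p finite_up_edges[OF fin] up_edges_subset[OF sub]] by simp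
    also have "\<dots> \<le> prb lamp_graph p (\<lambda>\<omega>. reach n \<omega> = S \<and> reach (Suc n) \<omega> = {})"
    proof (rule prb_mono)
      show "reach n \<omega> = S \<and> reach (Suc n) \<omega> = {}" if "reach n \<omega> = S \<and> ?R \<omega>" for \<omega>
        using that reach_Suc_empty by blast
      show "{\<omega> \<in> space (percolation lamp_graph p). reach n \<omega> = S \<and> reach (Suc n) \<omega> = {}} \<in> sets (percolation lamp_graph p)"
        by (intro sets_depends_on[OF _ _ depends_on_conj[OF depends_on_reach depends_on_reach]])
          (use finite_lamp_box lamp_box_subset in auto)
    qed
    finally show ?thesis .
  qed
  then have "(\<Sum>S\<in>level_sets n. prb lamp_graph p (\<lambda>\<omega>. reach n \<omega> = S) * ((1 - p) ^ \<alpha>) ^ card S)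
    \<le> prb lamp_graph p (\<lambda>\<omega>. reach (Suc n) \<omega> = {})"
    unfolding prb_reach_empty_total[of p "Suc n" n] by (rule sum_mono)
  then show ?thesis by (simp add: prb_reach_empty)
qed

lemma reach_0: "reach_prob p 0 = 1"
proof -
  have "origin \<in> reach 0 \<omega>" for \<omega> by (simp add: reach_def box_cluster_def) (simp add: origin_def)
  then have "reach_prob p 0 = prb lamp_graph p (\<lambda>_. True)" unfolding reach_prob_def by (metis empty_iff)
  then show ?thesis by (simp add: prb_True)
qed

lemma survival:
  assumes n: "0 < n" and e: "1 < reach_exp p n"
  shows "\<exists>\<epsilon>>0. \<forall>m. \<epsilon> \<le> reach_prob p m"
proof -
  define M where "M = real (card ({n} \<times> lamps_below n))"
  define \<epsilon> where "\<epsilon> = min 1 ((reach_exp p n - 1) / (M\<^sup>2 + 1))"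
  let ?\<pi> = "\<lambda>S. prb lamp_graph p (\<lambda>\<omega>. reach n \<omega> = S)"
  have M1: "0 < M\<^sup>2 + 1" by (simp add: add_nonneg_pos)
  have eps: "0 < \<epsilon>" "\<epsilon> \<le> 1" using e M1 by (auto simp: \<epsilon>_def)
  have "\<epsilon> * (M\<^sup>2 + 1) \<le> reach_exp p n - 1"
    using M1 by (simp add: \<epsilon>_def pos_le_divide_eq[symmetric])
  then have epsM: "\<epsilon> * M\<^sup>2 \<le> reach_exp p n - 1" using eps by (simp add: algebra_simps)
  \<comment> \<open>The choice of \<open>\<epsilon>\<close> makes it a lower bound that the renewal inequality reproduces.\<close>
  have "\<epsilon> \<le> reach_prob p (k * n)" for k
  proof (induction k)
    case 0 then show ?case using eps by (simp add: reach_0)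
  next
    case (Suc k)
    have "1 - reach_prob p (n + k * n) \<le> (\<Sum>S\<in>level_sets n. ?\<pi> S * (1 - reach_prob p (k * n)) ^ card S)"
      by (rule reach_renewal)
    also have "\<dots> \<le> (\<Sum>S\<in>level_sets n. ?\<pi> S * (1 - \<epsilon> * card S + \<epsilon>\<^sup>2 * M\<^sup>2))"
    proof (intro sum_mono mult_left_mono)
      fix S assume S: "S \<in> level_sets n"
      have "(1 - reach_prob p (k * n)) ^ card S \<le> (1 - \<epsilon>) ^ card S"
        using Suc reach_prob_bounds by (intro power_mono) auto
      also have "\<dots> \<le> 1 - \<epsilon> * card S + (\<epsilon> * card S)\<^sup>2" using eps by (intro power_one_minus_le) auto
      also have "(\<epsilon> * card S)\<^sup>2 \<le> (\<epsilon> * M)\<^sup>2"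
        using S finite_top_level eps unfolding M_def level_sets_def
        by (intro power_mono mult_left_mono) (auto intro: card_mono)
      finally show "(1 - reach_prob p (k * n)) ^ card S \<le> 1 - \<epsilon> * card S + \<epsilon>\<^sup>2 * M\<^sup>2"
        by (simp add: power_mult_distrib)
    qed simp
    also have "\<dots> = (1 + \<epsilon>\<^sup>2 * M\<^sup>2) * (\<Sum>S\<in>level_sets n. ?\<pi> S) - \<epsilon> * reach_exp p n"
      unfolding reach_exp_def sum_distrib_left sum_subtractf[symmetric]
      by (intro sum.cong refl) (simp add: algebra_simps)
    also have "\<dots> = 1 - \<epsilon> * (reach_exp p n - \<epsilon> * M\<^sup>2)"
      by (simp add: sum_reach algebra_simps power2_eq_square)
    also have "\<dots> \<le> 1 - \<epsilon> * 1" using epsM eps by (intro diff_left_mono mult_left_mono) auto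
    finally show ?case by simp
  qed
  then have "\<epsilon> \<le> reach_prob p m" for m
    using reach_prob_antimono[of m "m * n" p] n order_trans by fastforce
  then show ?thesis using eps by blast
qed

lemma extinction:
  assumes p: "0 \<le> p" "p < 1" and e: "\<And>n. 0 < n \<Longrightarrow> reach_exp p n \<le> 1"
  shows "reach_prob p \<longlonglongrightarrow> 0"
proof -
  define c where "c = (1 - p) ^ \<alpha>"
  have c: "0 < c" "c \<le> 1" using p by (auto simp: c_def power_le_one)
  \<comment> \<open>By Markov, \<open>S\<^sub>n\<close> is nonempty of size at most \<open>K\<close> with probability at least
      \<open>reach_prob p n - 1 / K\<close>, and then it dies at once with probability at least \<open>c ^ K\<close>.\<close>
  have step: "reach_prob p (Suc n) \<le> reach_prob p n - c ^ K * (reach_prob p n - 1 / K)"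
    if "0 < n" "0 < K" for n K :: nat
  proof -
    let ?\<pi> = "\<lambda>S. prb lamp_graph p (\<lambda>\<omega>. reach n \<omega> = S)"
    \<comment> \<open>Markov's inequality in pointwise form, to be averaged over the values of \<open>reach n\<close>.\<close>
    have pt: "(1 - c ^ K) * of_bool (S = {}) + c ^ K - c ^ K / K * card S \<le> c ^ card S" if "S \<in> level_sets n" for S
    proof (cases "S = {}")
      case True then show ?thesis by simp
    next
      case False
      show ?thesis
      proof (cases "card S \<le> K")
        case True
        have "c ^ K - c ^ K / K * card S \<le> c ^ K" using c by simp
        also have "\<dots> \<le> c ^ card S" using True c by (intro power_decreasing) auto
        finally show ?thesis using False by simp
      next
        case F: False
        then have "c ^ K * 1 \<le> c ^ K * (card S / K)" using c \<open>0 < K\<close> by (intro mult_left_mono) auto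
        then have "c ^ K - c ^ K / K * card S \<le> 0" by simp
        also have "\<dots> \<le> c ^ card S" using c by simp
        finally show ?thesis using False by simp
      qed
    qed
    have emp: "(\<Sum>S\<in>level_sets n. ?\<pi> S * of_bool (S = {})) = 1 - reach_prob p n"
    proof -
      have "(\<Sum>S\<in>level_sets n. ?\<pi> S * of_bool (S = {})) = (\<Sum>S\<in>{{}}. ?\<pi> S)"
        by (intro sum.mono_neutral_cong_right finite_level_sets) (auto simp: level_sets_def)
      then show ?thesis by (simp add: prb_reach_empty)
    qed
    have "(1 - c ^ K) * (1 - reach_prob p n) + c ^ K - c ^ K / K * reach_exp p n
        = (\<Sum>S\<in>level_sets n. ?\<pi> S * ((1 - c ^ K) * of_bool (S = {}) + c ^ K - c ^ K / K * card S))"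
    proof -
      have "(\<Sum>S\<in>level_sets n. ?\<pi> S * ((1 - c ^ K) * of_bool (S = {}) + c ^ K - c ^ K / K * card S))
        = (1 - c ^ K) * (\<Sum>S\<in>level_sets n. ?\<pi> S * of_bool (S = {})) + c ^ K * (\<Sum>S\<in>level_sets n. ?\<pi> S)
          - c ^ K / K * reach_exp p n"
        unfolding reach_exp_def sum_distrib_left sum_subtractf[symmetric] sum.distrib[symmetric]
        by (intro sum.cong refl) (simp add: algebra_simps)
      then show ?thesis by (simp add: emp sum_reach)
    qed
    also have "\<dots> \<le> (\<Sum>S\<in>level_sets n. ?\<pi> S * c ^ card S)"
      by (intro sum_mono mult_left_mono pt) auto
    also have "\<dots> \<le> 1 - reach_prob p (Suc n)"
      unfolding c_def using p by (intro reach_extinction) auto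
    finally have "(1 - c ^ K) * (1 - reach_prob p n) + c ^ K - c ^ K / K * reach_exp p n
      \<le> 1 - reach_prob p (Suc n)" .
    moreover have "c ^ K / K * reach_exp p n \<le> c ^ K / K * 1"
      using e[OF \<open>0 < n\<close>] c by (intro mult_left_mono) auto
    ultimately show ?thesis by (simp add: algebra_simps)
  qed
  have "decseq (reach_prob p)" by (auto simp: decseq_def intro: reach_prob_antimono)
  then obtain L where L: "reach_prob p \<longlonglongrightarrow> L"
    by (rule decseq_convergent[of _ 0]) (simp_all add: reach_prob_bounds)
  have "0 \<le> L" by (rule LIMSEQ_le_const[OF L]) (use reach_prob_bounds in auto)
  moreover have "L \<le> 1 / Suc K" for K
  proof -
    have "(\<lambda>n. reach_prob p (Suc n)) \<longlonglongrightarrow> L" using L by (rule LIMSEQ_Suc)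
    moreover have "(\<lambda>n. reach_prob p n - c ^ Suc K * (reach_prob p n - 1 / Suc K)) \<longlonglongrightarrow> L - c ^ Suc K * (L - 1 / Suc K)"
      by (intro tendsto_intros L)
    ultimately have "L \<le> L - c ^ Suc K * (L - 1 / Suc K)"
      by (rule LIMSEQ_le) (intro exI[of _ 1] allI impI step; simp)
    then have "c ^ Suc K * (L - 1 / Suc K) \<le> 0" by simp
    moreover have "0 < c ^ Suc K" using c by (intro zero_less_power)
    ultimately show ?thesis by (simp add: mult_le_0_iff del: power_Suc of_nat_Suc)
  qed
  then have "L \<le> 0"
    by (intro LIMSEQ_le_const[OF LIMSEQ_Suc[OF lim_1_over_n]]) blast
  ultimately show ?thesis using L by simp
qed

lemma reach_exp_one: "1 < reach_exp 1 1"
proof -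
  let ?\<pi> = "\<lambda>S. prb lamp_graph 1 (\<lambda>\<omega>. reach 1 \<omega> = S)"
  have open_2: "2 \<le> card (reach 1 \<omega>)" if "\<forall>e\<in>lamp_box 1. \<omega> e" for \<omega>
  proof -
    let ?w = "\<lambda>a. (1::nat, (\<lambda>_::nat. 0::nat)(0 := a))"
    have w: "?w a \<in> reach 1 \<omega>" if "a < \<alpha>" for a
    proof -
      have "{origin, ?w a} \<in> lamp_box 1"
      proof -
        have "{origin, ?w a} = lamp_edge 0 (\<lambda>_. 0) a" by (simp add: origin_def lamp_edge_def)
        moreover have "(\<lambda>_. 0) \<in> lamps_below 1" using alpha_pos by (simp add: lamps_below_def)
        ultimately show ?thesis unfolding lamp_box_def using that by blast
      qed
      then show ?thesis using \<open>\<forall>e\<in>lamp_box 1. \<omega> e\<close>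
        by (auto simp: reach_def box_cluster_def intro!: joined_step)
    qed
    have "card {?w 0, ?w 1} \<le> card (reach 1 \<omega>)"
      by (intro card_mono finite_reach) (use w[of 0] w[of 1] two_le in auto)
    moreover have "?w 0 \<noteq> ?w 1" by (auto simp: fun_eq_iff)
    ultimately show ?thesis by simp
  qed
  have "2 * ?\<pi> S \<le> card S * ?\<pi> S" if "S \<in> level_sets 1" for S
  proof (cases "2 \<le> card S")
    case True then show ?thesis by (intro mult_right_mono) auto
  next
    case False
    have dep: "depends_on (lamp_box 1) (\<lambda>\<omega>. \<not> (\<forall>e\<in>lamp_box 1. \<omega> e))" "depends_on (lamp_box 1) (\<lambda>\<omega>. \<forall>e\<in>lamp_box 1. \<omega> e)"
      by (auto simp: depends_on_def)
    have "?\<pi> S \<le> prb lamp_graph 1 (\<lambda>\<omega>. \<not> (\<forall>e\<in>lamp_box 1. \<omega> e))"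
      using False open_2 by (intro prb_mono sets_depends_on[OF finite_lamp_box lamp_box_subset dep(1)]) auto
    also have "\<dots> = 0"
      using prb_not[OF sets_depends_on[OF finite_lamp_box lamp_box_subset dep(2)]] prb_open(1)[OF _ _ finite_lamp_box lamp_box_subset, of 1 1]
      by simp
    finally have "?\<pi> S = 0" using prb_nonneg by (simp add: antisym)
    then show ?thesis by simp
  qed
  then have "(\<Sum>S\<in>level_sets 1. 2 * ?\<pi> S) \<le> reach_exp 1 1" unfolding reach_exp_def by (rule sum_mono)
  then show ?thesis unfolding sum_distrib_left[symmetric] sum_reach by simp
qed

lemma reach_exp_zero: "0 < n \<Longrightarrow> reach_exp 0 n \<le> 1"
proof -
  assume n: "0 < n"
  have "1 \<le> 1 - reach_prob 0 (Suc 0)" using reach_extinction[of 0 0] by (simp add: sum_reach)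
  then have "reach_prob 0 n \<le> 0" using reach_prob_antimono[of "Suc 0" n 0] n by simp
  moreover have "prb lamp_graph 0 (\<lambda>\<omega>. reach n \<omega> = S) \<le> reach_prob 0 n" if "S \<noteq> {}" for S
    unfolding reach_prob_def using that by (intro prb_mono) (auto intro: sets_reach)
  ultimately have "prb lamp_graph 0 (\<lambda>\<omega>. reach n \<omega> = S) = 0" if "S \<noteq> {}" for S
    using that prb_nonneg by (meson antisym order_trans)
  then have "card S * prb lamp_graph 0 (\<lambda>\<omega>. reach n \<omega> = S) = 0" for S by (cases "S = {}") auto
  then have "reach_exp 0 n = (\<Sum>S\<in>level_sets n. 0)" unfolding reach_exp_def by (intro sum.cong refl)
  then show ?thesis by simp
qed

lemma continuous_on_reach_exp: "continuous_on {0..1} (\<lambda>p. reach_exp p n)"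
  unfolding reach_exp_def
  by (intro continuous_intros continuous_on_prb[OF finite_lamp_box lamp_box_subset depends_on_reach])

section \<open>The lamp graph at the critical parameter\<close>

lemma finite_cluster_reach_empty:
  assumes v: "v \<in> verts lamp_graph" and fin: "finite (cluster lamp_graph \<omega> v)"
  shows "\<exists>m. reach m (pull v \<omega>) = {}"
proof (rule ccontr)
  assume "\<nexists>m. reach m (pull v \<omega>) = {}"
  then have "\<forall>m. \<exists>w. w \<in> reach m (pull v \<omega>)" by blast
  then obtain w where w: "\<And>m. w m \<in> reach m (pull v \<omega>)" by metis
  have "fst v + m \<in> fst ` cluster lamp_graph \<omega> v" for m
    using pull_reach_cluster[OF v w, of m] by (intro image_eqI[of _ _ "shift v (w m)"]) auto
  then have "range (\<lambda>m. fst v + m) \<subseteq> fst ` cluster lamp_graph \<omega> v" by auto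
  then have "finite (range (\<lambda>m. fst v + m))" using fin finite_subset by blast
  then show False using finite_imageD[of "\<lambda>m. fst v + m" UNIV] by (auto simp: inj_on_def)
qed

lemma infinite_cluster_almost_surely:
  assumes eps: "0 < \<epsilon>" "\<And>m. \<epsilon> \<le> reach_prob p m"
  shows "prb lamp_graph p (has_infinite_cluster lamp_graph) = 1"
proof -
  interpret prob_space "percolation lamp_graph p" by (rule prob_space_percolation)
  \<comment> \<open>Only lamp \<open>i\<close> is on at \<open>w i\<close>; it distinguishes the copy at \<open>w i\<close> from all later ones.\<close>
  define w where "w i = (Suc i, (\<lambda>_::nat. 0::nat)(i := 1))" for i
  have wV: "w i \<in> verts lamp_graph" for i
  proof -
    have "finite {j. ((\<lambda>_::nat. 0::nat)(i := 1)) j \<noteq> 0}" by (rule finite_subset[of _ "{i}"]) auto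
    then show ?thesis using two_le by (simp add: w_def verts_lamp_graph lamps_def)
  qed
  define B where "B N m \<omega> \<longleftrightarrow> (\<forall>i\<in>{..<N}. reach m (pull (w i) \<omega>) = {})" for N m \<omega>
  let ?S = "\<lambda>N m. {\<omega> \<in> space (percolation lamp_graph p). B N m \<omega>}"
  have dep: "depends_on (copy_box (w i) m) (\<lambda>\<omega>. reach m (pull (w i) \<omega>) = {})" for i m
    by (rule depends_on_pull)
  have B_sets: "?S N m \<in> sets (percolation lamp_graph p)" for N m
    unfolding B_def
    by (rule sets_depends_on[OF _ _ depends_on_Ball[OF dep]])
      (use finite_copy_box copy_box_subset[OF wV] in \<open>simp_all add: UN_subset_iff\<close>)
  have disj: "disjoint_family_on (\<lambda>i. copy_box (w i) m) {..<N}" for N m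
  proof -
    have "copy_box (w i) m \<inter> copy_box (w j) m = {}" if "i < j" for i j
      unfolding w_def using that by (intro copy_box_disjoint[of i]) auto
    then show ?thesis
      unfolding disjoint_family_on_def by (metis inf_commute linorder_neqE_nat)
  qed
  have B_le: "prb lamp_graph p (B N m) \<le> (1 - \<epsilon>) ^ N" for N m
  proof -
    have "prb lamp_graph p (B N m) = (\<Prod>i\<in>{..<N}. prb lamp_graph p (\<lambda>\<omega>. reach m (pull (w i) \<omega>) = {}))"
      unfolding B_def
      by (rule prb_independent[OF _ finite_copy_box copy_box_subset[OF wV] disj dep]) simp
    also have "\<dots> = (1 - reach_prob p m) ^ N"
      by (simp add: prb_pull[OF wV, where P = "\<lambda>R. R = {}"] prb_reach_empty)
    also have "\<dots> \<le> (1 - \<epsilon>) ^ N"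
      using eps reach_prob_bounds by (intro power_mono) auto
    finally show ?thesis .
  qed
  have no_inf: "prb lamp_graph p (\<lambda>\<omega>. \<not> has_infinite_cluster lamp_graph \<omega>) \<le> (1 - \<epsilon>) ^ N" for N
  proof -
    have inc: "incseq (?S N)"
      unfolding B_def incseq_def using reach_empty_mono by blast
    have "(\<lambda>m. prob (?S N m)) \<longlonglongrightarrow> prob (\<Union>m. ?S N m)"
      using B_sets inc by (intro finite_Lim_measure_incseq) auto
    then have lim: "prob (\<Union>m. ?S N m) \<le> (1 - \<epsilon>) ^ N"
      by (rule LIMSEQ_le_const2) (use B_le in \<open>auto simp: prb_def\<close>)
    have "{\<omega> \<in> space (percolation lamp_graph p). \<not> has_infinite_cluster lamp_graph \<omega>} \<subseteq> (\<Union>m. ?S N m)"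
    proof
      fix \<omega> assume \<omega>: "\<omega> \<in> {\<omega> \<in> space (percolation lamp_graph p). \<not> has_infinite_cluster lamp_graph \<omega>}"
      then have "\<exists>m. reach m (pull (w i) \<omega>) = {}" for i
        using finite_cluster_reach_empty[OF wV] wV by (auto simp: has_infinite_cluster_def)
      then obtain m where m: "\<And>i. reach (m i) (pull (w i) \<omega>) = {}" by metis
      have "m i \<le> sum m {..<N}" if "i < N" for i using that by (intro member_le_sum) auto
      then have "B N (sum m {..<N}) \<omega>" unfolding B_def using m reach_empty_mono by blast
      then show "\<omega> \<in> (\<Union>m. ?S N m)" using \<omega> by auto
    qed
    then have "prb lamp_graph p (\<lambda>\<omega>. \<not> has_infinite_cluster lamp_graph \<omega>) \<le> prob (\<Union>m. ?S N m)"
      unfolding prb_def using B_sets by (intro finite_measure_mono) auto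
    then show ?thesis using lim by simp
  qed
  have "\<epsilon> \<le> 1" using eps(2)[of 0] reach_prob_bounds[of p 0] by simp
  then have "(\<lambda>N. (1 - \<epsilon>) ^ N) \<longlonglongrightarrow> 0" using eps by (intro LIMSEQ_realpow_zero) auto
  then have "prb lamp_graph p (\<lambda>\<omega>. \<not> has_infinite_cluster lamp_graph \<omega>) \<le> 0"
    by (rule LIMSEQ_le_const) (use no_inf in blast)
  then show ?thesis
    using prb_not[OF sets_has_infinite_cluster[OF countable_verts_lamp_graph countable_edges_lamp_graph], of p]
      prb_le_1[of lamp_graph p "has_infinite_cluster lamp_graph"] by simp
qed

lemma prb_0_if_AE:
  assumes "AE \<omega> in percolation lamp_graph p. \<not> has_infinite_cluster lamp_graph \<omega>"
  shows "prb lamp_graph p (has_infinite_cluster lamp_graph) = 0"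
proof -
  interpret prob_space "percolation lamp_graph p" by (rule prob_space_percolation)
  show ?thesis
    using assms prob_Collect_eq_0[OF sets_has_infinite_cluster[OF countable_verts_lamp_graph countable_edges_lamp_graph]]
    by (simp add: prb_def)
qed

lemma no_infinite_cluster_if_extinction:
  assumes p: "0 < p" "p \<le> 1" and lim: "reach_prob p \<longlonglongrightarrow> 0"
  shows "prb lamp_graph p (has_infinite_cluster lamp_graph) = 0"
proof -
  interpret prob_space "percolation lamp_graph p" by (rule prob_space_percolation)
  have "AE \<omega> in percolation lamp_graph p. finite (cluster lamp_graph \<omega> v)" if v: "v \<in> verts lamp_graph" for v
  proof -
    obtain F where F: "F \<subseteq> edges lamp_graph" "finite F" "joined F origin v"
      using joined_finite_subset[OF connected_lamp_graph[OF v]] by blast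
    \<comment> \<open>The event that level \<open>m\<close> is reached once the edges in \<open>F\<close> have been opened; it is independent of \<open>F\<close>.\<close>
    define D where "D m \<omega> \<longleftrightarrow> reach m (\<lambda>e. \<omega> e \<or> e \<in> F) \<noteq> {}" for m \<omega>
    have dep: "depends_on (lamp_box m - F) (D m)" for m
      unfolding depends_on_def D_def
    proof (intro allI impI)
      fix \<omega> \<omega>' :: "(nat \<times> (nat \<Rightarrow> nat)) set \<Rightarrow> bool"
      assume "\<forall>e\<in>lamp_box m - F. \<omega> e = \<omega>' e"
      then show "(reach m (\<lambda>e. \<omega> e \<or> e \<in> F) \<noteq> {}) = (reach m (\<lambda>e. \<omega>' e \<or> e \<in> F) \<noteq> {})"
        by (intro depends_on_reach[of m "\<lambda>R. R \<noteq> {}", unfolded depends_on_def, rule_format]) auto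
    qed
    have fin: "finite (lamp_box m - F)" "lamp_box m - F \<subseteq> edges lamp_graph" for m using finite_lamp_box lamp_box_subset by auto
    let ?S = "\<lambda>m. {\<omega> \<in> space (percolation lamp_graph p). D m \<omega>}"
    have sets: "?S m \<in> sets (percolation lamp_graph p)" for m
      by (rule sets_depends_on[OF fin dep])
    have le: "prb lamp_graph p (D m) \<le> reach_prob p m / p ^ card F" for m
    proof -
      have depF: "depends_on F (\<lambda>\<omega>. \<forall>e\<in>F. \<omega> e)" by (auto simp: depends_on_def)
      have "p ^ card F * prb lamp_graph p (D m) = prb lamp_graph p (\<lambda>\<omega>. (\<forall>e\<in>F. \<omega> e) \<and> D m \<omega>)"
        using prb_independent2[OF F(2,1) depF fin dep, of m p] prb_open(1)[OF _ p(2) F(2,1)] p by auto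
      also have "\<dots> \<le> reach_prob p m"
        unfolding reach_prob_def
      proof (rule prb_mono[OF _ sets_reach[where P = "\<lambda>R. R \<noteq> {}"]])
        fix \<omega> :: "(nat \<times> (nat \<Rightarrow> nat)) set \<Rightarrow> bool"
        assume *: "(\<forall>e\<in>F. \<omega> e) \<and> D m \<omega>"
        then have "(\<lambda>e. \<omega> e \<or> e \<in> F) = \<omega>" by auto
        then show "reach m \<omega> \<noteq> {}" using * by (simp add: D_def)
      qed
      finally show ?thesis using p by (simp add: field_simps)
    qed
    have "prob (\<Inter>m. ?S m) \<le> reach_prob p m / p ^ card F" for m
    proof -
      have "prob (\<Inter>m. ?S m) \<le> prob (?S m)" using sets by (intro finite_measure_mono) auto
      then show ?thesis using le[of m] by (simp add: prb_def)
    qed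
    moreover have "(\<lambda>m. reach_prob p m / p ^ card F) \<longlonglongrightarrow> 0 / p ^ card F"
      using p by (intro tendsto_intros lim) auto
    ultimately have "prob (\<Inter>m. ?S m) \<le> 0"
      by (intro LIMSEQ_le_const[of _ 0]) auto
    then have null: "(\<Inter>m. ?S m) \<in> null_sets (percolation lamp_graph p)"
      using sets by (auto simp: null_sets_def emeasure_eq_measure measure_le_0_iff)
    show ?thesis
    proof (rule AE_I'[OF null], rule subsetI)
      fix \<omega> assume *: "\<omega> \<in> {\<omega> \<in> space (percolation lamp_graph p). \<not> finite (cluster lamp_graph \<omega> v)}"
      let ?\<omega> = "\<lambda>e. \<omega> e \<or> e \<in> F"
      have "cluster lamp_graph \<omega> v \<subseteq> cluster lamp_graph ?\<omega> origin"
      proof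
        fix w assume w: "w \<in> cluster lamp_graph \<omega> v"
        have "joined (open_edges lamp_graph ?\<omega>) origin v"
          using F by (auto simp: open_edges_def intro: joined_mono)
        moreover have "joined (open_edges lamp_graph ?\<omega>) v w"
          using w by (auto simp: cluster_def open_edges_def intro: joined_mono)
        ultimately show "w \<in> cluster lamp_graph ?\<omega> origin"
          using w by (auto simp: cluster_def intro: joined_trans)
      qed
      then have "infinite (cluster lamp_graph ?\<omega> origin)" using * finite_subset by blast
      then show "\<omega> \<in> (\<Inter>m. ?S m)" using infinite_cluster_reach * by (auto simp: D_def)
    qed
  qed
  then have "AE \<omega> in percolation lamp_graph p. \<forall>v\<in>verts lamp_graph. finite (cluster lamp_graph \<omega> v)"
    by (simp add: AE_ball_countable[OF countable_verts_lamp_graph])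
  then show ?thesis by (intro prb_0_if_AE) (simp add: has_infinite_cluster_def)
qed

lemma no_infinite_cluster_0: "prb lamp_graph 0 (has_infinite_cluster lamp_graph) = 0"
proof (rule prb_0_if_AE)
  interpret prob_space "percolation lamp_graph 0" by (rule prob_space_percolation)
  have "AE \<omega> in percolation lamp_graph 0. \<not> \<omega> e" if "e \<in> edges lamp_graph" for e
  proof -
    have "prb lamp_graph 0 (\<lambda>\<omega>. \<forall>e'\<in>{e}. \<omega> e') = 0 ^ card {e}"
      using that by (intro prb_open(1)) auto
    then have "prb lamp_graph 0 (\<lambda>\<omega>. \<omega> e) = 0" by simp
    moreover have "{\<omega> \<in> space (percolation lamp_graph 0). \<omega> e} \<in> sets (percolation lamp_graph 0)"
      using that by (intro sets_depends_on[of "{e}"]) (auto simp: depends_on_def)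
    ultimately show ?thesis using prob_Collect_eq_0 by (simp add: prb_def)
  qed
  then have "AE \<omega> in percolation lamp_graph 0. \<forall>e\<in>edges lamp_graph. \<not> \<omega> e"
    by (simp add: AE_ball_countable[OF countable_edges_lamp_graph])
  then show "AE \<omega> in percolation lamp_graph 0. \<not> has_infinite_cluster lamp_graph \<omega>"
  proof (rule eventually_mono)
    fix \<omega> assume "\<forall>e\<in>edges lamp_graph. \<not> \<omega> e"
    then have o: "open_edges lamp_graph \<omega> = {}" by (auto simp: open_edges_def)
    have "cluster lamp_graph \<omega> v \<subseteq> {v}" for v
    proof
      fix w assume "w \<in> cluster lamp_graph \<omega> v"
      then have "joined {} v w" by (simp add: cluster_def o)
      then show "w \<in> {v}" by (rule joined_closed) auto
    qed
    then show "\<not> has_infinite_cluster lamp_graph \<omega>"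
      unfolding has_infinite_cluster_def by (meson finite.emptyI finite_insert finite_subset)
  qed
qed

lemma no_percolation_at_critical_prob:
  "prb lamp_graph (critical_prob lamp_graph) (has_infinite_cluster lamp_graph) = 0"
proof -
  define A where "A = {p. 0 \<le> p \<and> p \<le> 1 \<and> prb lamp_graph p (has_infinite_cluster lamp_graph) = 1}"
  have pc: "critical_prob lamp_graph = Inf A" by (simp add: A_def critical_prob_prb)
  have mem: "p \<in> A" if "0 \<le> p" "p \<le> 1" "0 < n" "1 < reach_exp p n" for p n
    using survival[OF that(3,4)] infinite_cluster_almost_surely that(1,2) by (auto simp: A_def)
  have bdd: "bdd_below A" by (auto simp: A_def bdd_below_def)
  have less: "critical_prob lamp_graph < p" if p: "0 \<le> p" "p \<le> 1" "0 < n" "1 < reach_exp p n" for p n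
  proof -
    have "0 < p" using p reach_exp_zero[of n] by (cases "p = 0") auto
    have "(reach_exp' \<longlongrightarrow> reach_exp p n) (at p within {0..1})" if "reach_exp' = (\<lambda>p. reach_exp p n)" for reach_exp'
      using continuous_on_reach_exp[of n] p by (auto simp: continuous_on_def that)
    then have "((\<lambda>p. reach_exp p n) \<longlongrightarrow> reach_exp p n) (at p within {0..1})" by simp
    then have "eventually (\<lambda>q. 1 < reach_exp q n) (at p within {0..1})"
      using p(4) by (rule order_tendstoD)
    then obtain d where d: "0 < d" "\<And>q. q \<in> {0..1} \<Longrightarrow> q \<noteq> p \<Longrightarrow> dist q p < d \<Longrightarrow> 1 < reach_exp q n"
      unfolding eventually_at by blast
    \<comment> \<open>Continuity at \<open>p > 0\<close> gives a smaller parameter that still has an infinite cluster.\<close>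
    define q where "q = max 0 (p - d / 2)"
    have q: "0 \<le> q" "q < p" "q \<le> 1" "dist q p < d"
      using \<open>0 < p\<close> d(1) p by (auto simp: q_def dist_real_def)
    then have "q \<in> A" using d(2)[of q] p by (intro mem[of q n]) auto
    then have "critical_prob lamp_graph \<le> q" unfolding pc using bdd by (rule cInf_lower)
    then show ?thesis using q by simp
  qed
  have "1 \<in> A" using reach_exp_one by (intro mem[of 1 1]) auto
  then have "0 \<le> critical_prob lamp_graph" unfolding pc by (intro cInf_greatest) (auto simp: A_def)
  moreover have "critical_prob lamp_graph < 1" using reach_exp_one by (intro less[of 1 1]) auto
  ultimately have bounds: "0 \<le> critical_prob lamp_graph" "critical_prob lamp_graph < 1" by auto
  have "reach_exp (critical_prob lamp_graph) n \<le> 1" if "0 < n" for n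
    using less[of "critical_prob lamp_graph" n] bounds that by (force simp: not_less[symmetric])
  then have "reach_prob (critical_prob lamp_graph) \<longlonglongrightarrow> 0" using bounds by (intro extinction) auto
  then show ?thesis
    using no_infinite_cluster_if_extinction[of "critical_prob lamp_graph"] no_infinite_cluster_0 bounds
    by (cases "critical_prob lamp_graph = 0") auto
qed

end

section \<open>Trees with a chosen end\<close>

lemma joined_imp_distinct_path:
  assumes "joined F x y"
  shows "\<exists>xs. xs \<noteq> [] \<and> hd xs = x \<and> last xs = y \<and> distinct xs \<and> successively (\<lambda>a b. {a, b} \<in> F) xs"
  using assms unfolding joined_def
proof (induction rule: rtranclp_induct)
  case base
  show ?case by (intro exI[of _ "[x]"]) auto
next
  case (step y z)
  then obtain xs where xs: "xs \<noteq> []" "hd xs = x" "last xs = y" "distinct xs"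
    "successively (\<lambda>a b. {a, b} \<in> F) xs" by blast
  show ?case
  proof (cases "z \<in> set xs")
    case True
    then obtain ys zs where "xs = ys @ z # zs" using split_list by metis
    moreover from this have "successively (\<lambda>a b. {a, b} \<in> F) ((ys @ [z]) @ zs)" using xs(5) by simp
    then have "successively (\<lambda>a b. {a, b} \<in> F) (ys @ [z])" unfolding successively_append_iff by blast
    ultimately show ?thesis using xs
      by (intro exI[of _ "ys @ [z]"]) (cases ys, auto)
  next
    case False
    then show ?thesis using xs step.hyps(2)
      by (intro exI[of _ "xs @ [z]"]) (auto simp: successively_append_iff)
  qed
qed

lemma edge_distinct: "simple_graph G \<Longrightarrow> {u, v} \<in> edges G \<Longrightarrow> u \<noteq> v"
proof
  assume "simple_graph G" "{u, v} \<in> edges G" "u = v"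
  then have "card {u, v} = 2" unfolding simple_graph_def by (blast dest: bspec)
  with \<open>u = v\<close> show False by simp
qed

lemma edge_verts: "simple_graph G \<Longrightarrow> {u, v} \<in> edges G \<Longrightarrow> u \<in> verts G \<and> v \<in> verts G"
proof -
  assume "simple_graph G" "{u, v} \<in> edges G"
  then have "{u, v} \<subseteq> verts G" unfolding simple_graph_def by (blast dest: bspec)
  then show ?thesis by simp
qed

text \<open>
  In this form the absence of cycles is convenient: removing an edge separates its end points.
\<close>

lemma tree_edge_bridge:
  assumes T: "tree_graph T" and e: "{u, v} \<in> edges T"
  shows "\<not> joined (edges T - {{u, v}}) u v"
proof
  assume "joined (edges T - {{u, v}}) u v"
  then obtain xs where xs: "xs \<noteq> []" "hd xs = u" "last xs = v" "distinct xs"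
    "successively (\<lambda>a b. {a, b} \<in> edges T - {{u, v}}) xs"
    using joined_imp_distinct_path by metis
  have uv: "u \<noteq> v" using T edge_distinct[OF _ e] by (simp add: tree_graph_def)
  obtain ys where ys: "xs = u # ys" using xs by (cases xs) auto
  then obtain b zs where b: "ys = b # zs" using xs uv by (cases ys) auto
  have "zs \<noteq> []" using xs ys b by auto
  then have len: "3 \<le> length xs" using ys b by (cases zs) auto
  have "graph_cycle T xs"
    unfolding graph_cycle_def
  proof (intro conjI allI impI len xs(4))
    fix i assume i: "i < length xs"
    show "{xs ! i, xs ! (Suc i mod length xs)} \<in> edges T"
    proof (cases "Suc i < length xs")
      case True
      then show ?thesis using xs(5) by (auto simp: successively_conv_nth)
    next
      case False
      then have "i = length xs - 1" "Suc i = length xs" using i by auto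
      then have "xs ! i = v" "xs ! (Suc i mod length xs) = u"
        using xs by (auto simp: last_conv_nth hd_conv_nth)
      then show ?thesis using e by (simp add: insert_commute)
    qed
  qed
  then show False using T by (auto simp: tree_graph_def)
qed

lemma inj_ray_edge: "inj r \<Longrightarrow> inj (\<lambda>i::nat. {r i, r (Suc i)})"
  by (rule injI) (auto simp: doubleton_eq_iff inj_eq)

text \<open>
  A regular tree with a chosen end \<open>\<xi>\<close>. The orientation towards \<open>\<xi>\<close> is a function, called \<open>parent\<close>
  below; it has no periodic points, and every vertex has \<open>\<alpha>\<close> children.
\<close>

locale tree_with_end =
  fixes T :: "'a sgraph" and \<xi> :: "(nat \<Rightarrow> 'a) set" and \<alpha> :: nat
  assumes tree: "tree_graph T" and regular: "regular_graph (\<alpha> + 1) T" and is_end: "\<xi> \<in> tree_ends T"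
    and alpha_pos: "0 < \<alpha>"
begin

lemma simple: "simple_graph T" using tree by (simp add: tree_graph_def)

text \<open>
  The next vertex on the ray of \<open>\<xi>\<close> that starts at \<open>u\<close>.
\<close>

definition parent :: "'a \<Rightarrow> 'a" where
  "parent u = (SOME v. towards \<xi> u v)"

lemma ray_in_end: "r \<in> \<xi> \<Longrightarrow> ray T r"
  using is_end by (auto simp: tree_ends_def quotient_def ray_equiv_def)

lemma end_nonempty: "\<exists>r. r \<in> \<xi>"
  using is_end by (auto simp: tree_ends_def quotient_def ray_equiv_def)

lemma end_equiv: "r \<in> \<xi> \<Longrightarrow> s \<in> \<xi> \<Longrightarrow> finite (ray_edges r - ray_edges s)"
proof -
  assume rs: "r \<in> \<xi>" "s \<in> \<xi>"
  obtain q where q: "\<xi> = ray_equiv T `` {q}" using is_end by (auto simp: tree_ends_def quotient_def)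
  have "finite (ray_edges r - ray_edges q)" "finite (ray_edges q - ray_edges s)"
    using rs unfolding q by (auto simp: ray_equiv_def)
  then have "finite ((ray_edges r - ray_edges q) \<union> (ray_edges q - ray_edges s))" by simp
  then show ?thesis by (rule rev_finite_subset) blast
qed

lemma end_closed:
  assumes "r \<in> \<xi>" "ray T s" "finite (ray_edges r - ray_edges s)" "finite (ray_edges s - ray_edges r)"
  shows "s \<in> \<xi>"
proof -
  obtain q where q: "\<xi> = ray_equiv T `` {q}" using is_end by (auto simp: tree_ends_def quotient_def)
  have f: "ray T q" "finite (ray_edges q - ray_edges r)" "finite (ray_edges r - ray_edges q)"
    using assms(1) unfolding q by (auto simp: ray_equiv_def)
  have "finite ((ray_edges q - ray_edges r) \<union> (ray_edges r - ray_edges s))" using f assms by simp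
  then have 1: "finite (ray_edges q - ray_edges s)" by (rule rev_finite_subset) blast
  have "finite ((ray_edges s - ray_edges r) \<union> (ray_edges r - ray_edges q))" using f assms by simp
  then have "finite (ray_edges s - ray_edges q)" by (rule rev_finite_subset) blast
  then show ?thesis using 1 f assms(2) unfolding q by (auto simp: ray_equiv_def)
qed

lemma ray_edges_Suc: "ray_edges r = insert {r 0, r 1} (ray_edges (\<lambda>i. r (Suc i)))"
proof -
  have "range (\<lambda>i. {r i, r (Suc i)}) = insert {r 0, r 1} (range (\<lambda>i. {r (Suc i), r (Suc (Suc i))}))"
  proof (intro equalityI subsetI)
    fix e assume "e \<in> range (\<lambda>i. {r i, r (Suc i)})"
    then obtain i where "e = {r i, r (Suc i)}" by blast
    then show "e \<in> insert {r 0, r 1} (range (\<lambda>i. {r (Suc i), r (Suc (Suc i))}))" by (cases i) auto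
  qed auto
  then show ?thesis by (simp add: ray_edges_def)
qed

lemma end_tail: "r \<in> \<xi> \<Longrightarrow> (\<lambda>i. r (Suc i)) \<in> \<xi>"
proof (rule end_closed)
  assume r: "r \<in> \<xi>"
  show "r \<in> \<xi>" by fact
  show "ray T (\<lambda>i. r (Suc i))" using ray_in_end[OF r] by (auto simp: ray_def inj_def)
  show "finite (ray_edges r - ray_edges (\<lambda>i. r (Suc i)))"
    by (rule finite_subset[of _ "{{r 0, r 1}}"]) (use ray_edges_Suc[of r] in auto)
  show "finite (ray_edges (\<lambda>i. r (Suc i)) - ray_edges r)"
    by (rule finite_subset[of _ "{}"]) (use ray_edges_Suc[of r] in auto)
qed

lemma end_drop: "r \<in> \<xi> \<Longrightarrow> (\<lambda>i. r (n + i)) \<in> \<xi>"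
proof (induction n)
  case (Suc n)
  from end_tail[OF Suc.IH[OF Suc.prems]] show ?case by simp
qed simp

lemma end_cons:
  assumes r: "r \<in> \<xi>" and e: "{v, r 0} \<in> edges T" and v: "v \<notin> range r"
  shows "case_nat v r \<in> \<xi>"
proof (rule end_closed[OF r])
  have ray: "inj r" "\<And>i. {r i, r (Suc i)} \<in> edges T" using ray_in_end[OF r] by (auto simp: ray_def)
  show "ray T (case_nat v r)"
    unfolding ray_def
  proof (intro conjI allI injI)
    fix i j assume "case_nat v r i = case_nat v r j"
    then show "i = j" using v ray(1) by (auto simp: inj_eq split: nat.splits)
  next
    fix i show "{case_nat v r i, case_nat v r (Suc i)} \<in> edges T"
      using e ray(2) by (cases i) auto
  qed
  have eq: "ray_edges (case_nat v r) = insert {v, r 0} (ray_edges r)"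
    using ray_edges_Suc[of "case_nat v r"] by simp
  show "finite (ray_edges r - ray_edges (case_nat v r))" unfolding eq by (rule finite_subset[of _ "{}"]) auto
  show "finite (ray_edges (case_nat v r) - ray_edges r)" unfolding eq by (rule finite_subset[of _ "{{v, r 0}}"]) auto
qed

text \<open>
  Two rays of the same end share infinitely many edges, hence meet arbitrarily far out.
\<close>

lemma end_meet:
  assumes "r \<in> \<xi>" "s \<in> \<xi>"
  shows "\<exists>n\<ge>N. \<exists>m. r n = s m"
proof -
  have "inj r" using ray_in_end[OF assms(1)] by (simp add: ray_def)
  then have "infinite ((\<lambda>i. {r i, r (Suc i)}) ` {N..})"
    using inj_ray_edge[of r] by (metis finite_imageD infinite_Ici inj_on_subset subset_UNIV)
  then have "\<not> (\<lambda>i. {r i, r (Suc i)}) ` {N..} \<subseteq> ray_edges r - ray_edges s"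
    using end_equiv[OF assms] finite_subset by blast
  then obtain i where i: "N \<le> i" "{r i, r (Suc i)} \<in> ray_edges s" by (auto simp: ray_edges_def)
  then obtain j where "{r i, r (Suc i)} = {s j, s (Suc j)}" by (auto simp: ray_edges_def)
  then have "r i = s j \<or> r i = s (Suc j)" by (auto simp: doubleton_eq_iff)
  then show ?thesis using i by blast
qed

lemma ray_joined:
  assumes "\<And>k. i \<le> k \<Longrightarrow> k < j \<Longrightarrow> {r k, r (Suc k)} \<in> F" "i \<le> (j::nat)"
  shows "joined F (r i) (r j)"
  using assms(2,1)
proof (induction rule: dec_induct)
  case (step n)
  have "joined F (r i) (r n)" using step by (intro step.IH) simp
  moreover have "joined F (r n) (r (Suc n))" using step.hyps by (intro joined_step step.prems) auto
  ultimately show ?case by (rule joined_trans)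
qed simp

lemma end_unique_step:
  assumes r: "r \<in> \<xi>" and s: "s \<in> \<xi>" and same: "r 0 = s 0"
  shows "r 1 = s 1"
proof (rule ccontr)
  assume ne: "r 1 \<noteq> s 1"
  have rr: "inj r" "\<And>i. {r i, r (Suc i)} \<in> edges T" using ray_in_end[OF r] by (auto simp: ray_def)
  have ss: "inj s" "\<And>i. {s i, s (Suc i)} \<in> edges T" using ray_in_end[OF s] by (auto simp: ray_def)
  let ?F = "edges T - {{r 0, r 1}}"
  obtain n m where nm: "1 \<le> n" "r n = s m" using end_meet[OF r s, of 1] by blast
  have "joined ?F (r 1) (r n)"
  proof (rule ray_joined[OF _ nm(1)])
    fix k assume "1 \<le> k" "k < n"
    then have "r 0 \<notin> {r k, r (Suc k)}" using rr(1) by (auto simp: inj_eq)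
    then show "{r k, r (Suc k)} \<in> ?F" using rr(2)[of k] by auto
  qed
  moreover have "joined ?F (s 0) (s m)"
  proof (rule ray_joined)
    fix k
    show "{s k, s (Suc k)} \<in> ?F"
    proof (cases k)
      case 0 then show ?thesis using ss(2)[of 0] ne \<open>r 0 = s 0\<close> by (auto simp: doubleton_eq_iff)
    next
      case (Suc k')
      then have "s 0 \<notin> {s k, s (Suc k)}" using ss(1) by (auto simp: inj_eq)
      then show ?thesis using ss(2)[of k] same by auto
    qed
  qed simp
  ultimately have "joined ?F (r 0) (r 1)"
    unfolding nm(2)[symmetric] same[symmetric] by (rule joined_trans[OF _ joined_sym, rotated])
  then show False using tree_edge_bridge[OF tree rr(2)[of 0]] by simp
qed

lemma ray_from:
  assumes "u \<in> verts T"
  shows "\<exists>r\<in>\<xi>. r 0 = u"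
proof -
  obtain q where q: "q \<in> \<xi>" using end_nonempty by blast
  have "{q 0, q 1} \<in> edges T" using ray_in_end[OF q] by (simp add: ray_def)
  then have "q 0 \<in> verts T" using edge_verts[OF simple] by blast
  then have "joined (edges T) (q 0) u"
    using tree assms by (auto simp: tree_graph_def connected_graph_def)
  then have "u \<in> {u. \<exists>r\<in>\<xi>. r 0 = u}"
  proof (rule joined_closed)
    show "q 0 \<in> {u. \<exists>r\<in>\<xi>. r 0 = u}" using q by blast
    fix a b assume "a \<in> {u. \<exists>r\<in>\<xi>. r 0 = u}" and ab: "{a, b} \<in> edges T"
    then obtain r where r: "r \<in> \<xi>" "r 0 = a" by blast
    show "b \<in> {u. \<exists>r\<in>\<xi>. r 0 = u}"
    proof (cases "b \<in> range r")
      case True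
      then obtain i where "b = r i" by blast
      then show ?thesis using end_drop[OF r(1), of i] by (intro CollectI bexI[of _ "\<lambda>j. r (i + j)"]) auto
    next
      case False
      then have "case_nat b r \<in> \<xi>" using end_cons[OF r(1)] ab r(2) by (simp add: insert_commute)
      then show ?thesis by (intro CollectI bexI[of _ "case_nat b r"]) auto
    qed
  qed
  then show ?thesis by blast
qed

lemma towards_parent: "u \<in> verts T \<Longrightarrow> towards \<xi> u (parent u)"
  unfolding parent_def by (rule someI_ex) (use ray_from[of u] in \<open>auto simp: towards_def\<close>)

lemma towards_unique: "towards \<xi> u v \<Longrightarrow> towards \<xi> u w \<Longrightarrow> v = w"
  unfolding towards_def using end_unique_step by metis

lemma towards_edge: "towards \<xi> u v \<Longrightarrow> {u, v} \<in> edges T"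
  unfolding towards_def using ray_in_end by (auto simp: ray_def)

lemma towards_iff: "towards \<xi> u v \<longleftrightarrow> u \<in> verts T \<and> v = parent u"
  using towards_edge edge_verts[OF simple] towards_parent towards_unique by metis

lemma parent_edge: "u \<in> verts T \<Longrightarrow> {u, parent u} \<in> edges T"
  using towards_edge towards_parent by blast

lemma parent_in: "u \<in> verts T \<Longrightarrow> parent u \<in> verts T"
  using parent_edge edge_verts[OF simple] by blast

lemma funpow_parent_in: "u \<in> verts T \<Longrightarrow> (parent ^^ n) u \<in> verts T"
  by (induction n) (auto intro: parent_in)

lemma end_ray_parent: "r \<in> \<xi> \<Longrightarrow> r n = (parent ^^ n) (r 0)"
proof (induction n)
  case (Suc n)
  have "towards \<xi> (r n) (r (Suc n))"
    unfolding towards_def using end_drop[OF Suc.prems, of n] by (intro bexI[of _ "\<lambda>i. r (n + i)"]) auto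
  then show ?case using Suc by (simp add: towards_iff)
qed simp

lemma parent_aperiodic: "u \<in> verts T \<Longrightarrow> (parent ^^ n) u = u \<Longrightarrow> n = 0"
proof -
  assume "u \<in> verts T" and n: "(parent ^^ n) u = u"
  then obtain r where r: "r \<in> \<xi>" "r 0 = u" using ray_from by blast
  then have "r n = r 0" using end_ray_parent[of r n] n by simp
  then show "n = 0" using ray_in_end[OF r(1)] by (simp add: ray_def inj_eq)
qed

lemma parent_funpow_eq: "u \<in> verts T \<Longrightarrow> (parent ^^ n) u = (parent ^^ m) u \<Longrightarrow> n = m"
proof -
  have *: "n = m" if "u \<in> verts T" "(parent ^^ n) u = (parent ^^ m) u" "n \<le> m" for n m
  proof -
    have "(parent ^^ (m - n)) ((parent ^^ n) u) = (parent ^^ n) u"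
    proof -
      have "(parent ^^ (m - n)) ((parent ^^ n) u) = (parent ^^ (m - n + n)) u" by (simp add: funpow_add)
      then show ?thesis using that by simp
    qed
    then show ?thesis using parent_aperiodic[OF funpow_parent_in[OF that(1)]] that(3) by force
  qed
  assume "u \<in> verts T" "(parent ^^ n) u = (parent ^^ m) u"
  then show "n = m" using *[of n m] *[of m n] by (cases "n \<le> m") auto
qed

lemma edge_cases:
  assumes e: "{u, v} \<in> edges T"
  shows "v = parent u \<or> u = parent v"
proof -
  have uv: "u \<in> verts T" "v \<in> verts T" "u \<noteq> v" using e edge_verts[OF simple] edge_distinct[OF simple] by blast+
  obtain r where r: "r \<in> \<xi>" "r 0 = u" using ray_from uv by blast
  have rr: "inj r" "\<And>i. {r i, r (Suc i)} \<in> edges T" using ray_in_end[OF r(1)] by (auto simp: ray_def)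
  show ?thesis
  proof (cases "v \<in> range r")
    case False
    then have "case_nat v r \<in> \<xi>" using end_cons[OF r(1)] e r(2) by (simp add: insert_commute)
    from end_ray_parent[OF this, of 1] show ?thesis using r(2) by simp
  next
    case True
    then obtain i where i: "v = r i" by blast
    have "i = 1"
    proof (rule ccontr)
      assume "i \<noteq> 1"
      have "joined (edges T - {{u, v}}) (r 0) (r i)"
      proof (rule ray_joined)
        fix k
        have "{r k, r (Suc k)} \<noteq> {r 0, r i}"
          using rr(1) \<open>i \<noteq> 1\<close> by (auto simp: doubleton_eq_iff inj_eq)
        then show "{r k, r (Suc k)} \<in> edges T - {{u, v}}" using rr(2) i r(2) by simp
      qed simp
      then show False using tree_edge_bridge[OF tree e] i r(2) by simp
    qed
    then show ?thesis using end_ray_parent[OF r(1), of 1] r(2) i by simp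
  qed
qed

definition children :: "'a \<Rightarrow> 'a set" where
  "children u = {v \<in> verts T. parent v = u}"

lemma card_children:
  assumes u: "u \<in> verts T"
  shows "finite (children u)" "card (children u) = \<alpha>"
proof -
  let ?E = "{e \<in> edges T. u \<in> e}"
  have reg: "finite ?E" "card ?E = \<alpha> + 1" using regular u by (auto simp: regular_graph_def)
  have E: "?E = insert {u, parent u} ((\<lambda>v. {u, v}) ` children u)"
  proof (intro equalityI subsetI)
    fix e assume e: "e \<in> ?E"
    then have "card e = 2" using simple by (auto simp: simple_graph_def)
    then obtain x y where xy: "e = {x, y}" by (auto simp: card_2_iff)
    have "u \<in> e" using e by simp
    then obtain v where v: "e = {u, v}" unfolding xy by (metis insert_commute insertE singletonD)
    then have uv: "{u, v} \<in> edges T" using e by simp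
    from edge_cases[OF this] show "e \<in> insert {u, parent u} ((\<lambda>v. {u, v}) ` children u)"
      using v edge_verts[OF simple uv] by (auto simp: children_def)
  next
    fix e assume "e \<in> insert {u, parent u} ((\<lambda>v. {u, v}) ` children u)"
    then show "e \<in> ?E" using parent_edge u by (auto simp: children_def insert_commute)
  qed
  have notin: "{u, parent u} \<notin> (\<lambda>v. {u, v}) ` children u"
  proof
    assume "{u, parent u} \<in> (\<lambda>v. {u, v}) ` children u"
    then have "parent (parent u) = u" by (auto simp: children_def doubleton_eq_iff)
    then have "(parent ^^ 2) u = u" by (simp add: numeral_2_eq_2)
    then show False using parent_aperiodic[OF u, of 2] by simp
  qed
  have inj: "inj_on (\<lambda>v. {u, v}) (children u)" by (auto simp: inj_on_def doubleton_eq_iff)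
  have fin: "finite ((\<lambda>v. {u, v}) ` children u)" using reg(1) unfolding E by simp
  then show "finite (children u)" using inj by (rule finite_imageD)
  have "card ?E = Suc (card ((\<lambda>v. {u, v}) ` children u))"
    unfolding E by (rule card_insert_disjoint[OF fin notin])
  then show "card (children u) = \<alpha>" using reg card_image[OF inj] by simp
qed

text \<open>
  The children of each vertex can be labelled by \<open>0, \<dots>, \<alpha> - 1\<close> so that all labels on the ray starting at
  a given vertex are \<open>0\<close>.
\<close>

lemma labelling_exists:
  assumes o: "base \<in> verts T"
  shows "\<exists>lab. (\<forall>u\<in>verts T. bij_betw lab (children u) {..<\<alpha>}) \<and> (\<forall>i. lab ((parent ^^ i) base) = 0)"
proof -
  have bij: "\<exists>b. bij_betw b (children u) {..<\<alpha>} \<and> b c = 0" if uc: "u \<in> verts T" "c \<in> children u" for u c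
  proof -
    obtain h where h: "bij_betw h (children u) {0..<\<alpha>}"
      using ex_bij_betw_finite_nat[OF card_children(1)[OF uc(1)]] card_children(2)[OF uc(1)] by blast
    then have "h c \<in> {..<\<alpha>}" using uc(2) by (auto simp: bij_betw_def)
    then have "bij_betw (Transposition.transpose (h c) 0) {..<\<alpha>} {..<\<alpha>}"
      using alpha_pos by (intro bij_betwI[of _ _ _ "Transposition.transpose (h c) 0"]) (auto simp: Transposition.transpose_def)
    then have "bij_betw (Transposition.transpose (h c) 0 \<circ> h) (children u) {..<\<alpha>}"
      using h by (auto intro: bij_betw_trans simp: atLeast0LessThan)
    then show ?thesis by (intro exI[of _ "Transposition.transpose (h c) 0 \<circ> h"]) auto
  qed
  \<comment> \<open>\<open>c u\<close> is a child of \<open>u\<close>, namely the one on the ray from \<open>base\<close> if there is one; it gets label \<open>0\<close>.\<close>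
  define c where "c u = (if \<exists>i. (parent ^^ Suc i) base = u
    then (parent ^^ (SOME i. (parent ^^ Suc i) base = u)) base else SOME v. v \<in> children u)" for u
  have c_base: "c ((parent ^^ Suc i) base) = (parent ^^ i) base" for i
  proof -
    have "(SOME j. (parent ^^ Suc j) base = (parent ^^ Suc i) base) = i"
      by (rule some_equality) (use parent_funpow_eq[OF o, of _ "Suc i"] in blast)+
    then show ?thesis unfolding c_def by auto
  qed
  have c: "c u \<in> children u" if "u \<in> verts T" for u
  proof (cases "\<exists>i. (parent ^^ Suc i) base = u")
    case True
    then obtain i where i: "(parent ^^ Suc i) base = u" by blast
    then show ?thesis using c_base[of i] funpow_parent_in[OF o, of i] by (simp add: children_def)
  next
    case False
    have "children u \<noteq> {}" using card_children[OF that] alpha_pos by auto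
    then show ?thesis using False some_in_eq[of "children u"] by (simp add: c_def)
  qed
  obtain b where b: "\<And>u. u \<in> verts T \<Longrightarrow> bij_betw (b u) (children u) {..<\<alpha>} \<and> b u (c u) = 0"
    using bij[OF _ c] by metis
  show ?thesis
  proof (intro exI[of _ "\<lambda>v. b (parent v) v"] conjI ballI allI)
    fix u assume "u \<in> verts T"
    then show "bij_betw (\<lambda>v. b (parent v) v) (children u) {..<\<alpha>}"
      using b by (subst bij_betw_cong[of _ _ "b u"]) (auto simp: children_def)
  next
    fix i
    show "b (parent ((parent ^^ i) base)) ((parent ^^ i) base) = 0"
      using b[OF funpow_parent_in[OF o, of "Suc i"]] c_base[of i] by simp
  qed
qed

text \<open>
  A labelling of the vertices as above, each vertex being labelled as a child of its parent.
\<close>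

definition label :: "'a \<Rightarrow> 'a \<Rightarrow> nat" where
  "label base = (SOME lab. (\<forall>u\<in>verts T. bij_betw lab (children u) {..<\<alpha>}) \<and> (\<forall>i. lab ((parent ^^ i) base) = 0))"

lemma label:
  assumes "base \<in> verts T"
  shows "\<And>u. u \<in> verts T \<Longrightarrow> bij_betw (label base) (children u) {..<\<alpha>}"
    and "\<And>i. label base ((parent ^^ i) base) = 0"
  using someI_ex[OF labelling_exists[OF assms]] unfolding label_def by blast+

lemma label_less: "base \<in> verts T \<Longrightarrow> u \<in> verts T \<Longrightarrow> label base u < \<alpha>"
  using label(1)[of base "parent u"] parent_in[of u] by (auto simp: bij_betw_def children_def)

lemma label_inj:
  "base \<in> verts T \<Longrightarrow> u \<in> verts T \<Longrightarrow> v \<in> verts T \<Longrightarrow> parent u = parent v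
    \<Longrightarrow> label base u = label base v \<Longrightarrow> u = v"
  using label(1)[of base "parent u"] parent_in[of u] by (auto simp: bij_betw_def children_def inj_on_def)

lemma label_surj: "base \<in> verts T \<Longrightarrow> u \<in> verts T \<Longrightarrow> a < \<alpha> \<Longrightarrow> \<exists>v\<in>verts T. parent v = u \<and> label base v = a"
proof -
  assume "base \<in> verts T" "u \<in> verts T" "a < \<alpha>"
  then have "a \<in> label base ` children u" using label(1)[of base u] by (simp add: bij_betw_def)
  then show ?thesis by (auto simp: children_def)
qed

text \<open>
  A vertex is determined by its ancestor \<open>m\<close> generations up and the \<open>m\<close> labels on the way, and all
  combinations of these occur.
\<close>

lemma descend_unique:
  assumes "base \<in> verts T" "u \<in> verts T" "v \<in> verts T" "(parent ^^ m) u = (parent ^^ m) v"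
    and "\<And>j. j < m \<Longrightarrow> label base ((parent ^^ j) u) = label base ((parent ^^ j) v)"
  shows "u = v"
  using assms(2-)
proof (induction m arbitrary: u v)
  case (Suc m)
  have "label base ((parent ^^ j) (parent u)) = label base ((parent ^^ j) (parent v))" if "j < m" for j
    using Suc.prems(4)[of "Suc j"] that by (simp add: funpow_Suc_right del: funpow.simps)
  moreover have "(parent ^^ m) (parent u) = (parent ^^ m) (parent v)"
    using Suc.prems(3) by (simp add: funpow_Suc_right del: funpow.simps)
  ultimately have "parent u = parent v"
    by (intro Suc.IH[OF parent_in[OF Suc.prems(1)] parent_in[OF Suc.prems(2)]])
  then show ?case using Suc.prems(1,2) Suc.prems(4)[of 0] label_inj[OF assms(1)] by simp
qed simp

lemma descend_exists:
  assumes "base \<in> verts T" "w \<in> verts T" "\<And>j. j < m \<Longrightarrow> g j < \<alpha>"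
  shows "\<exists>u\<in>verts T. (parent ^^ m) u = w \<and> (\<forall>j<m. label base ((parent ^^ j) u) = g j)"
  using assms(3)
proof (induction m arbitrary: g)
  case 0 then show ?case using assms(2) by auto
next
  case (Suc m)
  obtain v where v: "v \<in> verts T" "(parent ^^ m) v = w" "\<And>j. j < m \<Longrightarrow> label base ((parent ^^ j) v) = g (Suc j)"
    using Suc.IH[of "\<lambda>j. g (Suc j)"] Suc.prems by auto
  obtain u where u: "u \<in> verts T" "parent u = v" "label base u = g 0"
    using label_surj[OF assms(1) v(1)] Suc.prems by blast
  have "label base ((parent ^^ j) u) = g j" if "j < Suc m" for j
    using that u v(3) by (cases j) (auto simp: funpow_Suc_right simp del: funpow.simps)
  then show ?case using u v by (intro bexI[of _ u]) (auto simp: funpow_Suc_right simp del: funpow.simps)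
qed

lemma descendant_iff:
  assumes "v \<in> verts T"
  shows "descendant \<xi> v u \<longleftrightarrow> (\<exists>k. (parent ^^ k) v = u)"
proof
  assume "descendant \<xi> v u"
  then show "\<exists>k. (parent ^^ k) v = u"
    unfolding descendant_def
  proof (induction rule: rtranclp_induct)
    case base then show ?case by (intro exI[of _ 0]) simp
  next
    case (step y z)
    then obtain k where "(parent ^^ k) v = y" by blast
    then show ?case using step.hyps(2) by (intro exI[of _ "Suc k"]) (simp add: towards_iff)
  qed
next
  assume "\<exists>k. (parent ^^ k) v = u"
  then obtain k where "(parent ^^ k) v = u" by blast
  moreover have "(towards \<xi>)\<^sup>*\<^sup>* v ((parent ^^ k) v)" for k
    by (induction k) (auto intro: rtranclp.rtrancl_into_rtrancl simp: towards_iff funpow_parent_in[OF assms])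
  ultimately show "descendant \<xi> v u" unfolding descendant_def by metis
qed

end

section \<open>The positive part as a lamp graph\<close>

text \<open>
  Two trees with ends and a base vertex \<open>(o1, o2)\<close>, which becomes the origin of the lamp graph.
\<close>

locale horocyclic = L: lamplighter \<alpha> + t1: tree_with_end T1 \<xi>1 \<alpha> + t2: tree_with_end T2 \<xi>2 \<alpha>
  for \<alpha> :: nat and T1 :: "'a sgraph" and \<xi>1 and T2 :: "'b sgraph" and \<xi>2 +
  fixes o1 :: 'a and o2 :: 'b
  assumes o1: "o1 \<in> verts T1" and o2: "o2 \<in> verts T2"
begin

abbreviation "par1 \<equiv> t1.parent"
abbreviation "par2 \<equiv> t2.parent"
abbreviation "HP \<equiv> horocyclic_product T1 \<xi>1 T2 \<xi>2"

lemma edges_HP: "edges HP = {{(x, par2 y), (par1 x, y)} | x y. x \<in> verts T1 \<and> y \<in> verts T2}"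
proof (intro equalityI subsetI)
  fix e assume "e \<in> edges HP"
  then obtain u1 u2 v1 v2 where e: "e = {(u1, u2), (v1, v2)}"
    "towards \<xi>1 u1 v1 \<and> towards \<xi>2 v2 u2 \<or> towards \<xi>1 v1 u1 \<and> towards \<xi>2 u2 v2"
    by (auto simp: horocyclic_product_def)
  from e(2) show "e \<in> {{(x, par2 y), (par1 x, y)} | x y. x \<in> verts T1 \<and> y \<in> verts T2}"
  proof
    assume "towards \<xi>1 u1 v1 \<and> towards \<xi>2 v2 u2"
    then show ?thesis using e(1) by (auto simp: t1.towards_iff t2.towards_iff)
  next
    assume "towards \<xi>1 v1 u1 \<and> towards \<xi>2 u2 v2"
    moreover from this have "e = {(v1, par2 u2), (par1 v1, u2)}"
      using e(1) by (auto simp: t1.towards_iff t2.towards_iff)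
    ultimately show ?thesis by (auto simp: t1.towards_iff t2.towards_iff)
  qed
next
  fix e assume "e \<in> {{(x, par2 y), (par1 x, y)} | x y. x \<in> verts T1 \<and> y \<in> verts T2}"
  then obtain x y where e: "e = {(x, par2 y), (par1 x, y)}" "x \<in> verts T1" "y \<in> verts T2" by blast
  have "{x, par1 x} \<in> edges T1" "{par2 y, y} \<in> edges T2" "towards \<xi>1 x (par1 x)" "towards \<xi>2 y (par2 y)"
    using e t1.parent_edge t2.parent_edge by (auto simp: insert_commute t1.towards_iff t2.towards_iff)
  then show "e \<in> edges HP" unfolding horocyclic_product_def e(1) by auto
qed

lemma verts_HP: "verts HP = verts T1 \<times> verts T2"
  by (simp add: horocyclic_product_def)

text \<open>
  The vertices of the positive part: those \<open>(x, y)\<close> where \<open>x\<close> lies \<open>k\<close> generations below \<open>o1\<close> and \<open>y\<close> lies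
  \<open>k\<close> generations above the level of \<open>o2\<close>.
\<close>

definition positive_verts :: "('a \<times> 'b) set" where
  "positive_verts = {(x, y). x \<in> verts T1 \<and> y \<in> verts T2 \<and>
     (\<exists>k m. (par1 ^^ k) x = o1 \<and> (par2 ^^ m) y = (par2 ^^ (m + k)) o2)}"

lemma joined_climb:
  assumes "x \<in> verts T1" "y \<in> verts T2"
  shows "joined (edges HP) ((par1 ^^ m) x, y) (x, (par2 ^^ m) y)"
  using assms
proof (induction m arbitrary: y)
  case (Suc m)
  have "{((par1 ^^ m) x, par2 y), (par1 ((par1 ^^ m) x), y)} \<in> edges HP"
    unfolding edges_HP using Suc.prems t1.funpow_parent_in by blast
  then have "joined (edges HP) ((par1 ^^ Suc m) x, y) ((par1 ^^ m) x, par2 y)"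
    by (intro joined_step) (simp add: insert_commute)
  also have "joined (edges HP) ((par1 ^^ m) x, par2 y) (x, (par2 ^^ m) (par2 y))"
    using Suc.prems by (intro Suc.IH t2.parent_in) auto
  finally (joined_trans) show ?case by (simp add: funpow_Suc_right del: funpow.simps)
qed simp

text \<open>
  The generation differences to \<open>(o1, o2)\<close> in the two trees add up to \<open>0\<close> throughout its component.
\<close>

lemma joined_level:
  assumes "joined (edges HP) (o1, o2) z"
  shows "\<exists>i j l m. fst z \<in> verts T1 \<and> snd z \<in> verts T2 \<and>
    (par1 ^^ i) (fst z) = (par1 ^^ j) o1 \<and> (par2 ^^ l) (snd z) = (par2 ^^ m) o2 \<and> i + l = j + m"
proof -
  let ?C = "{z. \<exists>i j l m. fst z \<in> verts T1 \<and> snd z \<in> verts T2 \<and>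
    (par1 ^^ i) (fst z) = (par1 ^^ j) o1 \<and> (par2 ^^ l) (snd z) = (par2 ^^ m) o2 \<and> i + l = j + m}"
  have "z \<in> ?C"
    using assms
  proof (rule joined_closed)
    show "(o1, o2) \<in> ?C" using o1 o2 by (auto intro!: exI[of _ 0])
    fix a b assume "a \<in> ?C" and ab: "{a, b} \<in> edges HP"
    then obtain i j l m where *: "(par1 ^^ i) (fst a) = (par1 ^^ j) o1" "(par2 ^^ l) (snd a) = (par2 ^^ m) o2"
      "i + l = j + m" by blast
    obtain x y where xy: "{a, b} = {(x, par2 y), (par1 x, y)}" "x \<in> verts T1" "y \<in> verts T2"
      using ab unfolding edges_HP by blast
    from xy(1) consider "a = (x, par2 y)" "b = (par1 x, y)" | "a = (par1 x, y)" "b = (x, par2 y)"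
      by (auto simp: doubleton_eq_iff)
    then show "b \<in> ?C"
    proof cases
      case 1
      have "(par1 ^^ i) (par1 x) = (par1 ^^ Suc j) o1" using * 1 by (simp flip: funpow_swap1)
      moreover have "(par2 ^^ Suc l) y = (par2 ^^ m) o2" using * 1 by (simp add: funpow_Suc_right del: funpow.simps)
      moreover have "i + Suc l = Suc j + m" using * by simp
      moreover have "fst b \<in> verts T1" "snd b \<in> verts T2" using 1 xy t1.parent_in by auto
      moreover have "fst b = par1 x" "snd b = y" using 1 by auto
      ultimately show ?thesis by (intro CollectI) metis
    next
      case 2
      have "(par1 ^^ Suc i) x = (par1 ^^ j) o1" using * 2 by (simp add: funpow_Suc_right del: funpow.simps)
      moreover have "(par2 ^^ l) (par2 y) = (par2 ^^ Suc m) o2" using * 2 by (simp flip: funpow_swap1)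
      moreover have "Suc i + l = j + Suc m" using * by simp
      moreover have "fst b \<in> verts T1" "snd b \<in> verts T2" using 2 xy t2.parent_in by auto
      moreover have "fst b = x" "snd b = par2 y" using 2 by auto
      ultimately show ?thesis by (intro CollectI) metis
    qed
  qed
  then show ?thesis by blast
qed

lemma positive_verts_eq:
  "positive_verts = {v \<in> verts HP. joined (edges HP) (o1, o2) v \<and> descendant \<xi>1 (fst v) o1}"
proof (intro equalityI subsetI)
  fix v assume "v \<in> positive_verts"
  then obtain x y k m where v: "v = (x, y)" "x \<in> verts T1" "y \<in> verts T2"
    and k: "(par1 ^^ k) x = o1" and m: "(par2 ^^ m) y = (par2 ^^ (m + k)) o2"
    by (auto simp: positive_verts_def)
  \<comment> \<open>Both \<open>(o1, o2)\<close> and \<open>(x, y)\<close> are joined to a vertex over the common ancestor of \<open>y\<close> and \<open>o2\<close>.\<close>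
  obtain x' where x': "x' \<in> verts T1" "(par1 ^^ m) x' = x"
    using t1.descend_exists[OF o1 v(2), of m "\<lambda>_. 0"] L.alpha_pos by blast
  have "joined (edges HP) (x, y) (x', (par2 ^^ m) y)" using joined_climb[OF x'(1) v(3), of m] x' by simp
  then have "joined (edges HP) (x', (par2 ^^ (m + k)) o2) (x, y)" unfolding m by (rule joined_sym)
  moreover have "joined (edges HP) ((par1 ^^ (m + k)) x', o2) (x', (par2 ^^ (m + k)) o2)"
    by (rule joined_climb[OF x'(1) o2])
  moreover have "(par1 ^^ (m + k)) x' = o1" using x' k by (simp add: add.commute[of m k] funpow_add)
  ultimately have "joined (edges HP) (o1, o2) (x, y)" by (metis joined_trans)
  then show "v \<in> {v \<in> verts HP. joined (edges HP) (o1, o2) v \<and> descendant \<xi>1 (fst v) o1}"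
    using v k by (auto simp: verts_HP t1.descendant_iff)
next
  fix v assume v: "v \<in> {v \<in> verts HP. joined (edges HP) (o1, o2) v \<and> descendant \<xi>1 (fst v) o1}"
  obtain x y where xy: "v = (x, y)" "x \<in> verts T1" "y \<in> verts T2" using v by (auto simp: verts_HP)
  obtain k where k: "(par1 ^^ k) x = o1" using v xy by (auto simp: t1.descendant_iff)
  obtain i j l m where *: "(par1 ^^ i) x = (par1 ^^ j) o1" "(par2 ^^ l) y = (par2 ^^ m) o2" "i + l = j + m"
    using joined_level[of v] v xy by auto
  have "(par1 ^^ i) x = (par1 ^^ (j + k)) x" using * k by (simp add: funpow_add)
  then have "i = j + k" by (rule t1.parent_funpow_eq[OF xy(2)])
  then have "m = l + k" using * by simp
  then show "v \<in> positive_verts" using xy k * by (auto simp: positive_verts_def)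
qed

text \<open>
  The generation of a descendant of \<open>o1\<close>.
\<close>

definition depth :: "'a \<Rightarrow> nat" where
  "depth x = (LEAST k. (par1 ^^ k) x = o1)"

lemma depth_eq: "x \<in> verts T1 \<Longrightarrow> (par1 ^^ k) x = o1 \<Longrightarrow> depth x = k"
  unfolding depth_def by (rule Least_equality) (use t1.parent_funpow_eq in blast)+

text \<open>
  The isomorphism onto the lamp graph. The lamps below the level \<open>k\<close> are the labels on the path from
  \<open>o1\<close> down to \<open>x\<close>; the lamps from \<open>k\<close> on are the labels on the ray from \<open>y\<close>. The ray from \<open>o2\<close> has
  labels \<open>0\<close>, whence the support is finite.
\<close>

definition code :: "'a \<times> 'b \<Rightarrow> nat \<times> (nat \<Rightarrow> nat)" where
  "code = (\<lambda>(x, y). (depth x, \<lambda>i. if i < depth x then t1.label o1 ((par1 ^^ (depth x - 1 - i)) x)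
     else t2.label o2 ((par2 ^^ (i - depth x)) y)))"

lemma code_eq:
  assumes "x \<in> verts T1" "(par1 ^^ k) x = o1"
  shows "code (x, y) = (k, \<lambda>i. if i < k then t1.label o1 ((par1 ^^ (k - 1 - i)) x)
     else t2.label o2 ((par2 ^^ (i - k)) y))"
  unfolding code_def prod.case depth_eq[OF assms] ..

lemma code_lamps: "z \<in> positive_verts \<Longrightarrow> code z \<in> verts L.lamp_graph"
proof -
  assume "z \<in> positive_verts"
  then obtain x y k m where z: "z = (x, y)" "x \<in> verts T1" "y \<in> verts T2" "(par1 ^^ k) x = o1"
    "(par2 ^^ m) y = (par2 ^^ (m + k)) o2" by (auto simp: positive_verts_def)
  have zero: "snd (code z) i = 0" if "\<not> i < m + k" for i
  proof -
    have "(par2 ^^ (i - k)) y = (par2 ^^ (i - k - m + m)) y" using that by simp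
    also have "\<dots> = (par2 ^^ (i - k - m)) ((par2 ^^ m) y)" by (simp only: funpow_add o_apply)
    also have "\<dots> = (par2 ^^ (i - k - m + (m + k))) o2" unfolding z(5) by (simp only: funpow_add o_apply)
    finally show ?thesis using that t2.label(2)[OF o2] by (simp add: z(1) code_eq[OF z(2,4)])
  qed
  have "{i. snd (code z) i \<noteq> 0} \<subseteq> {..<m + k}"
  proof
    fix i assume "i \<in> {i. snd (code z) i \<noteq> 0}"
    then show "i \<in> {..<m + k}" using zero[of i] by (cases "i < m + k") auto
  qed
  then have "finite {i. snd (code z) i \<noteq> 0}" by (rule finite_subset) simp
  moreover have "snd (code z) i < \<alpha>" for i
    using t1.label_less[OF o1 t1.funpow_parent_in[OF z(2)]] t2.label_less[OF o2 t2.funpow_parent_in[OF z(3)]]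
    by (simp add: z(1) code_eq[OF z(2,4)])
  ultimately show ?thesis by (cases "code z") (simp add: L.verts_lamp_graph L.lamps_def)
qed

lemma inj_on_code: "inj_on code positive_verts"
proof (rule inj_onI)
  fix z z' assume "z \<in> positive_verts" "z' \<in> positive_verts" and eq: "code z = code z'"
  then obtain x y k m x' y' k' m' where z: "z = (x, y)" "x \<in> verts T1" "y \<in> verts T2" "(par1 ^^ k) x = o1"
    "(par2 ^^ m) y = (par2 ^^ (m + k)) o2" and z': "z' = (x', y')" "x' \<in> verts T1" "y' \<in> verts T2"
    "(par1 ^^ k') x' = o1" "(par2 ^^ m') y' = (par2 ^^ (m' + k')) o2" by (auto simp: positive_verts_def)
  have k: "k' = k" using eq by (simp add: z(1) z'(1) code_eq[OF z(2,4)] code_eq[OF z'(2,4)])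
  have f: "snd (code z) i = snd (code z') i" for i using eq by simp
  have "x = x'"
  proof (rule t1.descend_unique[OF o1 z(2) z'(2)])
    show "(par1 ^^ k) x = (par1 ^^ k) x'" using z(4) z'(4) k by simp
    fix j assume "j < k"
    then have "k - 1 - j < k" "k - 1 - (k - 1 - j) = j" by auto
    then show "t1.label o1 ((par1 ^^ j) x) = t1.label o1 ((par1 ^^ j) x')"
      using f[of "k - 1 - j"] by (simp add: z(1) z'(1) code_eq[OF z(2,4)] code_eq[OF z'(2,4)] k)
  qed
  moreover have "y = y'"
  proof (rule t2.descend_unique[OF o2 z(3) z'(3)])
    have "(par2 ^^ (m' + m)) y = (par2 ^^ m') ((par2 ^^ m) y)" by (simp only: funpow_add o_apply)
    also have "\<dots> = (par2 ^^ (m' + (m + k))) o2" unfolding z(5) by (simp only: funpow_add o_apply)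
    also have "\<dots> = (par2 ^^ (m + (m' + k'))) o2" by (simp add: k ac_simps)
    also have "\<dots> = (par2 ^^ m) ((par2 ^^ m') y')" unfolding z'(5) by (simp only: funpow_add o_apply)
    also have "\<dots> = (par2 ^^ (m + m')) y'" by (simp only: funpow_add o_apply)
    finally show "(par2 ^^ (m' + m)) y = (par2 ^^ (m' + m)) y'" by (simp add: add.commute)
    fix j
    show "t2.label o2 ((par2 ^^ j) y) = t2.label o2 ((par2 ^^ j) y')"
      using f[of "k + j"] by (simp add: z(1) z'(1) code_eq[OF z(2,4)] code_eq[OF z'(2,4)] k)
  qed
  ultimately show "z = z'" using z z' by simp
qed

lemma code_surj:
  assumes "f \<in> L.lamps"
  shows "\<exists>x y m. x \<in> verts T1 \<and> y \<in> verts T2 \<and> (par1 ^^ k) x = o1 \<and> (par2 ^^ m) y = (par2 ^^ (m + k)) o2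
    \<and> code (x, y) = (k, f)"
proof -
  obtain m where m: "f \<in> L.lamps_below m" using assms L.lamps_eq_Union by auto
  have f: "f i < \<alpha>" for i using assms by (simp add: L.lamps_def)
  obtain x where x: "x \<in> verts T1" "(par1 ^^ k) x = o1"
    "\<And>j. j < k \<Longrightarrow> t1.label o1 ((par1 ^^ j) x) = f (k - 1 - j)"
    using t1.descend_exists[OF o1 o1, of k "\<lambda>j. f (k - 1 - j)"] f by blast
  obtain y where y: "y \<in> verts T2" "(par2 ^^ m) y = (par2 ^^ (m + k)) o2"
    "\<And>j. j < m \<Longrightarrow> t2.label o2 ((par2 ^^ j) y) = f (k + j)"
    using t2.descend_exists[OF o2 t2.funpow_parent_in[OF o2], of m "\<lambda>j. f (k + j)" "m + k"] f by blast
  have "(if i < k then t1.label o1 ((par1 ^^ (k - 1 - i)) x) else t2.label o2 ((par2 ^^ (i - k)) y)) = f i" for i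
  proof -
    consider "i < k" | "k \<le> i" "i < k + m" | "k + m \<le> i" by linarith
    then show ?thesis
    proof cases
      case 1 then show ?thesis using x(3)[of "k - 1 - i"] by simp
    next
      case 2 then show ?thesis using y(3)[of "i - k"] by simp
    next
      case 3
      have "(par2 ^^ (i - k)) y = (par2 ^^ (i - k - m + m)) y" using 3 by simp
      also have "\<dots> = (par2 ^^ (i - k - m)) ((par2 ^^ m) y)" by (simp only: funpow_add o_apply)
      also have "\<dots> = (par2 ^^ (i - k - m + (m + k))) o2" unfolding y(2) by (simp only: funpow_add o_apply)
      finally show ?thesis using 3 m t2.label(2)[OF o2] by (simp add: L.lamps_below_def)
    qed
  qed
  then have "code (x, y) = (k, f)" by (simp add: code_eq[OF x(1,2)])
  then show ?thesis using x(1,2) y(1,2) by blast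
qed

lemma code_edge:
  assumes "x \<in> verts T1" "(par1 ^^ k) (par1 x) = o1"
  shows "code ` {(x, par2 y), (par1 x, y)} = L.lamp_edge k (snd (code (par1 x, y))) (t1.label o1 x)"
proof -
  have x: "(par1 ^^ Suc k) x = o1" using assms(2) by (simp add: funpow_Suc_right del: funpow.simps)
  have "code (x, par2 y) = (Suc k, (snd (code (par1 x, y)))(k := t1.label o1 x))"
  proof -
    have "(par1 ^^ (k - i)) x = (par1 ^^ (k - Suc i)) (par1 x)" if "i < k" for i
    proof -
      have "k - i = Suc (k - Suc i)" using that by simp
      then show ?thesis by (simp add: funpow_Suc_right del: funpow.simps)
    qed
    moreover have "(par2 ^^ (i - Suc k)) (par2 y) = (par2 ^^ (i - k)) y" if "k < i" for i
    proof -
      have "i - k = Suc (i - Suc k)" using that by simp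
      then show ?thesis by (simp add: funpow_Suc_right del: funpow.simps)
    qed
    ultimately show ?thesis
      unfolding code_eq[OF assms(1) x] code_eq[OF t1.parent_in[OF assms(1)] assms(2)]
      by (auto simp: fun_eq_iff less_Suc_eq)
  qed
  moreover have "code (par1 x, y) = (k, snd (code (par1 x, y)))"
    by (simp add: code_eq[OF t1.parent_in[OF assms(1)] assms(2)])
  ultimately show ?thesis unfolding L.lamp_edge_def by (simp add: insert_commute)
qed

lemma positive_edge_depth:
  assumes "{(x, par2 y), (par1 x, y)} \<subseteq> positive_verts" obtains k where "(par1 ^^ k) (par1 x) = o1"
  using assms by (auto simp: positive_verts_def)

lemma graph_iso_code:
  assumes "verts P = positive_verts" "edges P = {e \<in> edges HP. e \<subseteq> positive_verts}"
  shows "graph_iso code P L.lamp_graph"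
  unfolding graph_iso_def assms(1)
proof (intro conjI)
  show "edges P \<subseteq> Pow positive_verts" using assms(2) by auto
  show "bij_betw code positive_verts (verts L.lamp_graph)"
    unfolding bij_betw_def
  proof (intro conjI inj_on_code equalityI subsetI)
    fix w assume "w \<in> verts L.lamp_graph"
    then obtain k f where w: "w = (k, f)" "f \<in> L.lamps" by (auto simp: L.verts_lamp_graph)
    obtain x y m where "x \<in> verts T1" "y \<in> verts T2" "(par1 ^^ k) x = o1" "(par2 ^^ m) y = (par2 ^^ (m + k)) o2"
      and c: "code (x, y) = (k, f)" using code_surj[OF w(2), of k] by blast
    then have "(x, y) \<in> positive_verts" by (auto simp: positive_verts_def)
    then show "w \<in> code ` positive_verts" using c w(1) by (metis imageI)
  qed (use code_lamps in auto)
  show "edges L.lamp_graph = (\<lambda>e. code ` e) ` edges P"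
  proof (intro equalityI subsetI)
    fix e assume "e \<in> edges L.lamp_graph"
    then obtain k f a where e: "e = L.lamp_edge k f a" "f \<in> L.lamps" "a < \<alpha>" by (auto simp: L.edges_lamp_graph)
    obtain u y m where u: "u \<in> verts T1" "y \<in> verts T2" "(par1 ^^ k) u = o1" "(par2 ^^ m) y = (par2 ^^ (m + k)) o2"
      and c: "code (u, y) = (k, f)" using code_surj[OF e(2), of k] by blast
    obtain x where x: "x \<in> verts T1" "par1 x = u" "t1.label o1 x = a" using t1.label_surj[OF o1 u(1) e(3)] by blast
    have "(par1 ^^ Suc k) x = o1" using u x by (simp add: funpow_Suc_right del: funpow.simps)
    moreover have "(par2 ^^ m) (par2 y) = (par2 ^^ (m + Suc k)) o2"
      using arg_cong[OF u(4), of par2] by (simp add: funpow_swap1[symmetric])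
    ultimately have "(x, par2 y) \<in> positive_verts" using x t2.parent_in[OF u(2)] unfolding positive_verts_def by blast
    moreover have "(par1 x, y) \<in> positive_verts" using u x unfolding positive_verts_def by blast
    ultimately have "{(x, par2 y), (par1 x, y)} \<in> edges P"
      unfolding assms(2) edges_HP using x(1) u(2) by blast
    moreover have "code ` {(x, par2 y), (par1 x, y)} = e"
      using code_edge[OF x(1), of k y] x u(3) c e(1) by simp
    ultimately show "e \<in> (\<lambda>e. code ` e) ` edges P" by blast
  next
    fix e assume "e \<in> (\<lambda>e. code ` e) ` edges P"
    then obtain x y where xy: "e = code ` {(x, par2 y), (par1 x, y)}" "x \<in> verts T1" "y \<in> verts T2"
      "{(x, par2 y), (par1 x, y)} \<subseteq> positive_verts" unfolding assms(2) edges_HP by blast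
    obtain k where k: "(par1 ^^ k) (par1 x) = o1" using positive_edge_depth[OF xy(4)] by blast
    have "snd (code (par1 x, y)) \<in> L.lamps" using code_lamps[of "(par1 x, y)"] xy(4) by (auto simp: L.verts_lamp_graph)
    then show "e \<in> edges L.lamp_graph"
      unfolding xy(1) code_edge[OF xy(2) k] L.edges_lamp_graph using t1.label_less[OF o1 xy(2)] by blast
  qed
qed

lemma no_infinite_cluster:
  assumes "verts P = positive_verts" "edges P = {e \<in> edges HP. e \<subseteq> positive_verts}"
  shows "AE \<omega> in percolation P (critical_prob P). \<not> has_infinite_cluster P \<omega>"
proof -
  have iso: "graph_iso code P L.lamp_graph" by (rule graph_iso_code[OF assms])
  have V: "countable (verts P)"
    using iso L.countable_verts_lamp_graph by (auto simp: graph_iso_def bij_betw_def countable_image_inj_eq)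
  have "inj_on (\<lambda>e. code ` e) (edges P)"
    using iso unfolding graph_iso_def bij_betw_def by (meson inj_on_image_Pow inj_on_subset)
  then have E: "countable (edges P)"
    using iso L.countable_edges_lamp_graph by (auto simp: graph_iso_def countable_image_inj_eq)
  have eq: "prb P p (has_infinite_cluster P) = prb L.lamp_graph p (has_infinite_cluster L.lamp_graph)" for p
    using prb_has_infinite_cluster_iso[OF iso V E] by simp
  have "critical_prob P = critical_prob L.lamp_graph" unfolding critical_prob_prb eq ..
  then show ?thesis
    using AE_no_infinite_cluster[OF V E] L.no_percolation_at_critical_prob eq by simp
qed

end

theorem mainTheorem4:
  fixes \<alpha> :: nat
    and T1 :: "'a sgraph" and \<xi>1 :: "(nat \<Rightarrow> 'a) set"
    and T2 :: "'b sgraph" and \<xi>2 :: "(nat \<Rightarrow> 'b) set"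
    and \<Gamma> :: "('a \<times> 'b) sgraph" and x0 :: "'a \<times> 'b"
  assumes "2 \<le> \<alpha>"
    and "diestel_leader \<alpha> T1 \<xi>1 T2 \<xi>2 \<Gamma>"
    and "x0 \<in> verts \<Gamma>"
  defines "\<Gamma>pos \<equiv> positive_part \<xi>1 \<Gamma> x0"
  shows "AE \<omega> in percolation \<Gamma>pos (critical_prob \<Gamma>pos). \<not> has_infinite_cluster \<Gamma>pos \<omega>"
proof -
  let ?HP = "horocyclic_product T1 \<xi>1 T2 \<xi>2"
  let ?R = "{(u, v). u \<in> verts ?HP \<and> v \<in> verts ?HP \<and> joined (edges ?HP) u v}"
  have dl: "tree_graph T1" "regular_graph (\<alpha> + 1) T1" "\<xi>1 \<in> tree_ends T1"
    "tree_graph T2" "regular_graph (\<alpha> + 1) T2" "\<xi>2 \<in> tree_ends T2" "\<Gamma> \<in> graph_components ?HP"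
    using assms(2) by (auto simp: diestel_leader_def)
  obtain w where w: "\<Gamma> = induced_subgraph ?HP (?R `` {w})"
    using dl(7) unfolding graph_components_def quotient_def by blast
  have x0: "w \<in> verts ?HP" "x0 \<in> verts ?HP" "joined (edges ?HP) w x0"
    using assms(3) by (auto simp: w induced_subgraph_def)
  have "?R `` {w} = {v \<in> verts ?HP. joined (edges ?HP) x0 v}"
    using x0 by (auto intro: joined_trans joined_sym)
  note \<Gamma> = w[unfolded this]
  have vT: "fst x0 \<in> verts T1" "snd x0 \<in> verts T2" using x0(2) by (auto simp: horocyclic_product_def)
  interpret horocyclic \<alpha> T1 \<xi>1 T2 \<xi>2 "fst x0" "snd x0"
    by unfold_locales (use assms(1) dl vT in auto)
  show ?thesis
  proof (rule no_infinite_cluster)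
    show "verts \<Gamma>pos = positive_verts"
      unfolding \<Gamma>pos_def positive_part_def \<Gamma> positive_verts_eq by (auto simp: induced_subgraph_def)
    show "edges \<Gamma>pos = {e \<in> edges ?HP. e \<subseteq> positive_verts}"
      unfolding \<Gamma>pos_def positive_part_def \<Gamma> positive_verts_eq by (auto simp: induced_subgraph_def)
  qed
qed

end
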